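(* Let $R$ be a finite commutative ring with identity and $P$ a proper prime ideal of $R$ with $|P|\geq 2$; let $I=I(\Gamma_P(R))\subseteq S=k[x_1,\ldots,x_a,y_1,\ldots,y_b]$ be the edge ideal of the prime ideal graph. For every integer $n\geq 1$, the ideal $I^n$ has a $2n$-linear minimal free resolution. In particular, $$\operatorname{reg}(I^n)=2n.$$ Thus $I$ has linear powers.
   Context: The prime ideal graph $\Gamma_P(R)$ is the simple graph with vertex set $R\setminus\{0\}$ in which two distinct vertices $x,y$ are adjacent if and only if $xy\in P$. Put $a=|P|-1$ and $b=|P|(|R/P|-1)=|R\setminus P|$. Write $P\setminus\{0\}=\{u_1,\ldots,u_a\}$, $R\setminus P=\{v_1,\ldots,v_b\}$; attach the variable $x_i$ to $u_i$ and $y_\ell$ to $v_\ell$. Let $k$ be a field and $S=k[x_1,\ldots,x_a,y_1,\ldots,y_b]$, standard graded. The edge ideal $I=I(\Gamma_P(R))$ is the ideal of $S$ generated by the products of the two variables attached to the endpoints of each edge; explicitly $I=(x_ix_j,\;x_iy_\ell \mid 1\leq i<j\leq a,\;1\leq i\leq a,\;1\leq \ell\leq b)$. A homogeneous ideal $L$ has a $d$-linear minimal free resolution if its graded Betti numbers $\beta_{i,j}(L)=\dim_k\operatorname{Tor}_i^S(L,k)_j$ vanish for $j\neq i+d$. $\operatorname{reg}$ is Castelnuovo–Mumford regularity, $\operatorname{reg}(L)=\max\{j-i:\beta_{i,j}(L)\neq 0\}$. An ideal has linear powers if every power $I^n$, $n\geq 1$, has a linear minimal free resolution. *)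

theory Defs
  imports
    "HOL-Algebra.Ideal_Product"
    "HOL-Library.Poly_Mapping"
    "Jordan_Normal_Form.VS_Connect"
begin

section \<open>Polynomial rings\<close>

text \<open>
  Monomials are finitely supported exponent functions, polynomials are finitely supported
  coefficient functions on monomials.  The type contains polynomials in all variables of type
  \<open>'v\<close>; the ring \<open>k[V]\<close> consists of those that only involve variables from \<open>V\<close>.
\<close>

type_synonym ('v, 'k) mpoly = "('v \<Rightarrow>\<^sub>0 nat) \<Rightarrow>\<^sub>0 'k"

definition mvar :: "'v \<Rightarrow> ('v, 'k::field) mpoly" where
  "mvar v = Poly_Mapping.single (Poly_Mapping.single v 1) 1"

definition polys :: "'v set \<Rightarrow> ('v, 'k::field) mpoly set" where
  "polys V = {p. \<forall>m \<in> Poly_Mapping.keys p. Poly_Mapping.keys m \<subseteq> V}"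

definition poly_ring :: "'v set \<Rightarrow> ('v, 'k::field) mpoly ring" where
  "poly_ring V = \<lparr>carrier = polys V, mult = (*), one = 1, zero = 0, add = (+)\<rparr>"

definition mon_degree :: "('v \<Rightarrow>\<^sub>0 nat) \<Rightarrow> nat" where
  "mon_degree m = (\<Sum>v \<in> Poly_Mapping.keys m. Poly_Mapping.lookup m v)"

text \<open>The zero polynomial is homogeneous of every degree, including the negative ones.\<close>

definition homogeneous :: "int \<Rightarrow> ('v, 'k::field) mpoly \<Rightarrow> bool" where
  "homogeneous j p \<longleftrightarrow> (\<forall>m \<in> Poly_Mapping.keys p. int (mon_degree m) = j)"


section \<open>Graded free resolutions\<close>

text \<open>
  A complex \<open>\<dots> \<rightarrow> F\<^sub>1 \<rightarrow> F\<^sub>0 \<rightarrow> S\<close> of finitely generated graded free modules: \<open>F\<^sub>i\<close> has one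
  basis vector of degree \<open>degs F i ! c\<close> for each \<open>c < length (degs F i)\<close>, so it is the direct sum
  of the modules \<open>S(- degs F i ! c)\<close>; \<open>bd F i\<close> is the matrix of \<open>F\<^sub>i\<^sub>+\<^sub>1 \<rightarrow> F\<^sub>i\<close>, and
  \<open>aug F\<close> lists the images of the basis vectors of \<open>F\<^sub>0\<close> in \<open>S\<close>.
\<close>

record (overloaded) ('v, 'k) free_complex =
  degs :: "nat \<Rightarrow> int list"
  bd :: "nat \<Rightarrow> ('v, 'k) mpoly mat"
  aug :: "('v, 'k) mpoly vec"

abbreviation rk :: "('v, 'k) free_complex \<Rightarrow> nat \<Rightarrow> nat" where
  "rk F i \<equiv> length (degs F i)"

definition free_module :: "'v set \<Rightarrow> nat \<Rightarrow> ('v, 'k::field) mpoly vec set" where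
  "free_module V r = {v \<in> carrier_vec r. \<forall>c < r. v $ c \<in> polys V}"

text \<open>
  The homogeneity conditions say that the maps preserve degrees; exactness at \<open>F\<^sub>0\<close>, exactness at
  \<open>F\<^sub>i\<^sub>+\<^sub>1\<close>, and surjectivity onto the ideal \<open>L\<close> make it a resolution of \<open>L\<close>
  (not of the quotient \<open>S/L\<close>).
\<close>

definition graded_free_resolution ::
  "'v set \<Rightarrow> ('v, 'k::field) mpoly set \<Rightarrow> ('v, 'k) free_complex \<Rightarrow> bool" where
  "graded_free_resolution V L F \<longleftrightarrow>
     aug F \<in> free_module V (rk F 0) \<and>
     (\<forall>c < rk F 0. homogeneous (degs F 0 ! c) (aug F $ c)) \<and>
     (\<forall>i. bd F i \<in> carrier_mat (rk F i) (rk F (Suc i)) \<and>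
          (\<forall>r < rk F i. \<forall>c < rk F (Suc i).
             bd F i $$ (r, c) \<in> polys V \<and>
             homogeneous (degs F (Suc i) ! c - degs F i ! r) (bd F i $$ (r, c)))) \<and>
     {aug F \<bullet> v |v. v \<in> free_module V (rk F 0)} = L \<and>
     {v \<in> free_module V (rk F 0). aug F \<bullet> v = 0} =
       {bd F 0 *\<^sub>v w |w. w \<in> free_module V (rk F 1)} \<and>
     (\<forall>i. {v \<in> free_module V (rk F (Suc i)). bd F i *\<^sub>v v = 0\<^sub>v (rk F i)} =
          {bd F (Suc i) *\<^sub>v w |w. w \<in> free_module V (rk F (Suc (Suc i)))})"


section \<open>Graded Betti numbers\<close>

text \<open>
  Here \<open>k\<close> is the residue field of \<open>S\<close> at the ideal generated by the variables, so tensoring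
  \<open>F\<close> with \<open>k\<close> replaces \<open>F\<^sub>i\<close> by \<open>k\<^bsup>rk F i\<^esup>\<close> and every matrix entry by its constant term.
  The grading is the one inherited from the degrees of the basis vectors.
\<close>

definition bd_k :: "('v, 'k::field) free_complex \<Rightarrow> nat \<Rightarrow> 'k mat" where
  "bd_k F i = map_mat (\<lambda>p. Poly_Mapping.lookup p 0) (bd F i)"

definition chains_k :: "('v, 'k::field) free_complex \<Rightarrow> nat \<Rightarrow> int \<Rightarrow> 'k vec set" where
  "chains_k F i j = {v \<in> carrier_vec (rk F i). \<forall>c < rk F i. degs F i ! c \<noteq> j \<longrightarrow> v $ c = 0}"

definition cycles_k :: "('v, 'k::field) free_complex \<Rightarrow> nat \<Rightarrow> int \<Rightarrow> 'k vec set" where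
  "cycles_k F i j =
     (case i of 0 \<Rightarrow> chains_k F 0 j
      | Suc i' \<Rightarrow> {v \<in> chains_k F i j. bd_k F i' *\<^sub>v v = 0\<^sub>v (rk F i')})"

definition boundaries_k :: "('v, 'k::field) free_complex \<Rightarrow> nat \<Rightarrow> int \<Rightarrow> 'k vec set" where
  "boundaries_k F i j = {bd_k F i *\<^sub>v w |w. w \<in> chains_k F (Suc i) j}"

definition subspace_dim :: "nat \<Rightarrow> 'k::field vec set \<Rightarrow> nat" where
  "subspace_dim r W = vectorspace.dim class_ring (module_vec TYPE('k) r \<lparr>carrier := W\<rparr>)"

text \<open>The dimension of the degree \<open>j\<close> part of the \<open>i\<close>-th homology of \<open>F\<close> tensored with \<open>k\<close>.\<close>

definition tor_dim :: "('v, 'k::field) free_complex \<Rightarrow> nat \<Rightarrow> int \<Rightarrow> nat" where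
  "tor_dim F i j =
     subspace_dim (rk F i) (cycles_k F i j) - subspace_dim (rk F i) (boundaries_k F i j)"

text \<open>
  \<open>Tor\<close> is computed from an arbitrary (not necessarily minimal) graded free resolution of \<open>L\<close>.
  For finite \<open>V\<close> and a homogeneous ideal \<open>L\<close> one exists by Hilbert's basis theorem, and the value
  does not depend on the choice.
\<close>

definition graded_betti :: "'v set \<Rightarrow> ('v, 'k::field) mpoly set \<Rightarrow> nat \<Rightarrow> int \<Rightarrow> nat" where
  "graded_betti V L i j = tor_dim (SOME F. graded_free_resolution V L F) i j"

definition has_linear_resolution :: "'v set \<Rightarrow> nat \<Rightarrow> ('v, 'k::field) mpoly set \<Rightarrow> bool" where
  "has_linear_resolution V d L \<longleftrightarrow> (\<forall>i j. j \<noteq> int i + int d \<longrightarrow> graded_betti V L i j = 0)"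

text \<open>
  For a nonzero homogeneous ideal the set below is finite (Hilbert's syzygy theorem) and nonempty.
\<close>

definition regularity :: "'v set \<Rightarrow> ('v, 'k::field) mpoly set \<Rightarrow> int" where
  "regularity V L = Max {j - int i |i j. graded_betti V L i j \<noteq> 0}"

text \<open>Powers are taken in the multiplicative monoid of ideals of \<open>k[V]\<close>.\<close>

definition ideal_power ::
  "'v set \<Rightarrow> ('v, 'k::field) mpoly set \<Rightarrow> nat \<Rightarrow> ('v, 'k) mpoly set" where
  "ideal_power V L n = L [^]\<^bsub>ideals_set (poly_ring V)\<^esub> n"

definition has_linear_powers :: "'v set \<Rightarrow> ('v, 'k::field) mpoly set \<Rightarrow> bool" where
  "has_linear_powers V L \<longleftrightarrow>
     (\<forall>n \<ge> 1. \<exists>d. has_linear_resolution V d (ideal_power V L n))"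


section \<open>The prime ideal graph and its edge ideal\<close>

text \<open>A simple graph is given by its vertex set and its set of two-element edges.\<close>

type_synonym 'v sgraph = "'v set \<times> 'v set set"

definition prime_ideal_graph :: "('r, 'b) ring_scheme \<Rightarrow> 'r set \<Rightarrow> 'r sgraph" where
  "prime_ideal_graph R P =
     (carrier R - {\<zero>\<^bsub>R\<^esub>},
      {{x, y} |x y. x \<in> carrier R - {\<zero>\<^bsub>R\<^esub>} \<and> y \<in> carrier R - {\<zero>\<^bsub>R\<^esub>} \<and> x \<noteq> y \<and>
                    x \<otimes>\<^bsub>R\<^esub> y \<in> P})"

text \<open>The vertices themselves serve as the variables.\<close>

definition edge_ideal :: "'v sgraph \<Rightarrow> ('v, 'k::field) mpoly set" where
  "edge_ideal G = Idl\<^bsub>poly_ring (fst G)\<^esub> {mvar x * mvar y |x y. {x, y} \<in> snd G}"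

end

theory Submission
  imports Defs "HOL-Library.List_Lexorder"
begin

text \<open>
  For a prime ideal \<open>P\<close> the product \<open>x y\<close> lies in \<open>P\<close> exactly if \<open>x\<close> or \<open>y\<close> does.  Hence two
  different vertices fail to be adjacent only if both lie outside \<open>P\<close>: the prime ideal graph is
  complete multipartite, with the single elements of \<open>P \<setminus> {0}\<close> and the whole set \<open>R \<setminus> P\<close> as parts.
  For such a graph the monomials that are products of \<open>n\<close> edges are the monomials of degree \<open>2n\<close>
  whose degree in the variables of each part is at most \<open>n\<close> (\<open>edge_power_monomials_Suc\<close>).  This
  set of monomials has the exchange property of the bases of a polymatroid
  (\<open>polymatroidal_edge_power_monomials\<close>).

  An ideal generated by a polymatroidal set of monomials has linear quotients: if the generators
  are ordered lexicographically by their exponents, the ideal of the polynomials that multiply a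
  generator into the ideal of its predecessors is generated by variables
  (\<open>polymatroidal_linear_quotients\<close>).  The notion makes sense for any finite family of vectors
  over the polynomial ring, and the syzygies of a family with linear quotients are generated by
  a family of vectors of linear forms that has linear quotients again
  (\<open>syzygies_of_linear_quotients\<close>).  Iterating this yields a linear free resolution without
  Koszul complexes or mapping cones, and without any bound on its length.

  The Betti numbers are computed from an arbitrary graded free resolution \<open>F\<close>.  Comparison maps
  between \<open>F\<close> and the linear resolution \<open>G\<close>, together with a homotopy between the
  composition \<open>F \<rightarrow> G \<rightarrow> F\<close> and the identity, show that a cycle of \<open>F \<otimes> k\<close> is a boundary in every
  degree in which \<open>G\<close> has no basis vector (\<open>cycles_k_subset_boundaries_k\<close>).  So all Betti
  numbers off the linear strand vanish.  The Betti number in homological degree 0 and internal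
  degree \<open>2n\<close> does not vanish, because the ideal has no element of smaller degree and a nonzero
  form of degree \<open>2n\<close> (\<open>tor_dim_initial_degree\<close>).  This gives the regularity.
\<close>


section \<open>Monomials and homogeneous polynomials\<close>

abbreviation (input) monomial :: "('v \<Rightarrow>\<^sub>0 nat) \<Rightarrow> ('v, 'k::field) mpoly" where
  "monomial m \<equiv> Poly_Mapping.single m 1"

lemma keys_add_nat:
  fixes a b :: "'v \<Rightarrow>\<^sub>0 nat"
  shows "Poly_Mapping.keys (a + b) = Poly_Mapping.keys a \<union> Poly_Mapping.keys b"
  by (auto simp: in_keys_iff lookup_add)

lemma mon_degree_superset:
  assumes "finite A" "Poly_Mapping.keys m \<subseteq> A"
  shows "mon_degree m = (\<Sum>v\<in>A. Poly_Mapping.lookup m v)"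
  unfolding mon_degree_def using assms
  by (intro sum.mono_neutral_left) (auto simp: in_keys_iff)

lemma mon_degree_add: "mon_degree (a + b) = mon_degree a + mon_degree b"
proof -
  have "finite (Poly_Mapping.keys a \<union> Poly_Mapping.keys b)" by simp
  then show ?thesis
    by (simp add: mon_degree_superset[where A = "Poly_Mapping.keys a \<union> Poly_Mapping.keys b"]
        keys_add_nat lookup_add sum.distrib)
qed

lemma mon_degree_zero [simp]: "mon_degree 0 = 0"
  by (simp add: mon_degree_def)

lemma mon_degree_eq_0_iff [simp]: "mon_degree m = 0 \<longleftrightarrow> m = 0"
  by (auto simp: mon_degree_def in_keys_iff poly_mapping_eq_iff fun_eq_iff)

lemma mon_degree_single [simp]: "mon_degree (Poly_Mapping.single v n) = n"
  by (simp add: mon_degree_def)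

lemma monomial_add_eq_0_iff:
  fixes a b :: "'v \<Rightarrow>\<^sub>0 nat"
  shows "a + b = 0 \<longleftrightarrow> a = 0 \<and> b = 0"
  by (metis add.right_neutral add_is_0 mon_degree_add mon_degree_eq_0_iff)

lemma monomial_divides_iff:
  fixes a b :: "'v \<Rightarrow>\<^sub>0 nat"
  shows "(\<exists>c. b = a + c) \<longleftrightarrow> (\<forall>v. Poly_Mapping.lookup a v \<le> Poly_Mapping.lookup b v)"
proof
  assume "\<forall>v. Poly_Mapping.lookup a v \<le> Poly_Mapping.lookup b v"
  then have "b = a + (b - a)"
    by (intro poly_mapping_eqI) (simp add: lookup_add lookup_minus)
  then show "\<exists>c. b = a + c" ..
qed (auto simp: lookup_add)

lemma lookup_single_mult:
  fixes p :: "('v, 'k::field) mpoly"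
  shows "Poly_Mapping.lookup (Poly_Mapping.single a c * p) (a + m) = c * Poly_Mapping.lookup p m"
  by (simp add: lookup_mult lookup_single when_mult)

lemma keys_mult_single:
  fixes p :: "('v, 'k::field) mpoly"
  assumes "m \<in> Poly_Mapping.keys p" "c \<noteq> 0"
  shows "m + a \<in> Poly_Mapping.keys (p * Poly_Mapping.single a c)"
  using assms by (simp add: in_keys_iff lookup_single_mult mult.commute[of p] add.commute[of m])

lemma poly_eq_sum_monomials:
  "p = (\<Sum>m\<in>Poly_Mapping.keys p. Poly_Mapping.single m (Poly_Mapping.lookup p m))"
  by (rule poly_mapping_eqI)
     (simp add: lookup_sum lookup_single when_def in_keys_iff)

lemma keys_sum_subset:
  "Poly_Mapping.keys (\<Sum>i\<in>A. f i) \<subseteq> (\<Union>i\<in>A. Poly_Mapping.keys (f i))"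
proof
  fix m assume "m \<in> Poly_Mapping.keys (\<Sum>i\<in>A. f i)"
  then have "(\<Sum>i\<in>A. Poly_Mapping.lookup (f i) m) \<noteq> 0" by (simp add: in_keys_iff lookup_sum)
  then obtain i where "i \<in> A" "Poly_Mapping.lookup (f i) m \<noteq> 0" by (meson sum.neutral)
  then show "m \<in> (\<Union>i\<in>A. Poly_Mapping.keys (f i))" by (auto simp: in_keys_iff)
qed

lemma polys_0 [simp]: "0 \<in> polys V" and polys_1 [simp]: "1 \<in> polys V"
  by (auto simp: polys_def)

lemma polys_single: "Poly_Mapping.keys m \<subseteq> V \<Longrightarrow> Poly_Mapping.single m c \<in> polys V"
  by (auto simp: polys_def split: if_splits)

lemma polys_mvar: "v \<in> V \<Longrightarrow> mvar v \<in> polys V"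
  unfolding mvar_def by (rule polys_single) simp

lemma polys_add: "p \<in> polys V \<Longrightarrow> q \<in> polys V \<Longrightarrow> p + q \<in> polys V"
  using Poly_Mapping.keys_add[of p q] by (auto simp: polys_def)

lemma polys_uminus: "p \<in> polys V \<Longrightarrow> - p \<in> polys V"
  by (auto simp: polys_def in_keys_iff)

lemma polys_diff: "p \<in> polys V \<Longrightarrow> q \<in> polys V \<Longrightarrow> p - q \<in> polys V"
  using polys_add[of p V "- q"] polys_uminus[of q V] by simp

lemma polys_mult:
  assumes "p \<in> polys V" "q \<in> polys V" shows "p * q \<in> polys V"
  unfolding polys_def
proof clarify
  fix m v assume m: "m \<in> Poly_Mapping.keys (p * q)" and v: "v \<in> Poly_Mapping.keys m"
  from m obtain a b where "m = a + b" "a \<in> Poly_Mapping.keys p" "b \<in> Poly_Mapping.keys q"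
    using keys_mult[of p q] by blast
  then show "v \<in> V" using assms v unfolding polys_def by (auto simp: keys_add_nat)
qed

lemma polys_sum: "(\<And>i. i \<in> A \<Longrightarrow> f i \<in> polys V) \<Longrightarrow> (\<Sum>i\<in>A. f i) \<in> polys V"
  by (induction A rule: infinite_finite_induct) (auto intro: polys_add)

lemmas polys_closed = polys_add polys_diff polys_uminus polys_mult polys_sum polys_mvar

lemma homogeneous_0 [simp]: "homogeneous j 0"
  by (simp add: homogeneous_def)

lemma homogeneous_single: "int (mon_degree m) = j \<Longrightarrow> homogeneous j (Poly_Mapping.single m c)"
  by (simp add: homogeneous_def)

lemma homogeneous_mvar [simp]: "homogeneous 1 (mvar v)"
  unfolding mvar_def by (rule homogeneous_single) simp

lemma homogeneous_1: "homogeneous 0 1"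
  by (simp add: homogeneous_def)

lemma homogeneous_add: "homogeneous j p \<Longrightarrow> homogeneous j q \<Longrightarrow> homogeneous j (p + q)"
  using Poly_Mapping.keys_add[of p q] by (auto simp: homogeneous_def)

lemma homogeneous_uminus: "homogeneous j p \<Longrightarrow> homogeneous j (- p)"
  by (auto simp: homogeneous_def in_keys_iff)

lemma homogeneous_diff: "homogeneous j p \<Longrightarrow> homogeneous j q \<Longrightarrow> homogeneous j (p - q)"
  using homogeneous_add[of j p "- q"] homogeneous_uminus[of j q] by simp

lemma homogeneous_mult:
  assumes "homogeneous i p" "homogeneous j q" shows "homogeneous (i + j) (p * q)"
  unfolding homogeneous_def
proof
  fix m assume "m \<in> Poly_Mapping.keys (p * q)"
  then obtain a b where "m = a + b" "a \<in> Poly_Mapping.keys p" "b \<in> Poly_Mapping.keys q"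
    using keys_mult[of p q] by auto
  then show "int (mon_degree m) = i + j" using assms by (auto simp: homogeneous_def mon_degree_add)
qed

lemma homogeneous_sum: "(\<And>i. i \<in> A \<Longrightarrow> homogeneous j (f i)) \<Longrightarrow> homogeneous j (\<Sum>i\<in>A. f i)"
  by (induction A rule: infinite_finite_induct) (auto intro: homogeneous_add)

lemma homogeneous_const_term: "homogeneous j p \<Longrightarrow> j \<noteq> 0 \<Longrightarrow> Poly_Mapping.lookup p 0 = 0"
  by (auto simp: homogeneous_def in_keys_iff)

lemma homogeneous_neg: "homogeneous j p \<Longrightarrow> j < 0 \<Longrightarrow> p = 0"
  by (auto simp: homogeneous_def in_keys_iff intro!: poly_mapping_eqI)

lemma homogeneous_deg0:
  assumes "homogeneous 0 p" shows "p = Poly_Mapping.single 0 (Poly_Mapping.lookup p 0)"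
proof (rule poly_mapping_eqI)
  fix m show "Poly_Mapping.lookup p m =
    Poly_Mapping.lookup (Poly_Mapping.single 0 (Poly_Mapping.lookup p 0)) m"
    using assms by (auto simp: homogeneous_def in_keys_iff lookup_single when_def)
qed

text \<open>
  The homogeneous component of degree \<open>j\<close>; the degree is an integer because the entries of a
  graded matrix may have a negative degree, where every component is zero.
\<close>

definition hcomp :: "int \<Rightarrow> ('v, 'k::field) mpoly \<Rightarrow> ('v, 'k) mpoly" where
  "hcomp j p = Poly_Mapping.mapp (\<lambda>m c. c when int (mon_degree m) = j) p"

lemma lookup_hcomp:
  "Poly_Mapping.lookup (hcomp j p) m = (if int (mon_degree m) = j then Poly_Mapping.lookup p m else 0)"
  by (auto simp: hcomp_def lookup_mapp when_def in_keys_iff)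

lemma hcomp_add: "hcomp j (p + q) = hcomp j p + hcomp j q"
  by (rule poly_mapping_eqI) (simp add: lookup_hcomp lookup_add)

lemma hcomp_0 [simp]: "hcomp j 0 = 0"
  by (rule poly_mapping_eqI) (simp add: lookup_hcomp)

lemma hcomp_sum: "hcomp j (\<Sum>i\<in>A. f i) = (\<Sum>i\<in>A. hcomp j (f i))"
  by (induction A rule: infinite_finite_induct) (auto simp: hcomp_add)

lemma hcomp_polys: "p \<in> polys V \<Longrightarrow> hcomp j p \<in> polys V"
  by (auto simp: polys_def in_keys_iff lookup_hcomp split: if_splits)

lemma homogeneous_hcomp: "homogeneous j (hcomp j p)"
  by (auto simp: homogeneous_def in_keys_iff lookup_hcomp split: if_splits)

lemma hcomp_homogeneous: "homogeneous e p \<Longrightarrow> hcomp j p = (if j = e then p else 0)"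
  by (rule poly_mapping_eqI) (auto simp: homogeneous_def in_keys_iff lookup_hcomp)

text \<open>
  Taking components commutes with multiplication by a homogeneous factor.  This is what turns
  an arbitrary solution of a homogeneous linear equation into a homogeneous one.
\<close>

lemma hcomp_mult:
  assumes q: "homogeneous e q" shows "hcomp j (p * q) = hcomp (j - e) p * q"
proof -
  let ?c = "\<lambda>m. Poly_Mapping.single m (Poly_Mapping.lookup p m)"
  have mono: "hcomp j (?c m * q) = hcomp (j - e) (?c m) * q" for m
  proof -
    have 1: "homogeneous (int (mon_degree m)) (?c m)" by (simp add: homogeneous_single)
    from hcomp_homogeneous[OF homogeneous_mult[OF 1 q], of j] hcomp_homogeneous[OF 1, of "j - e"]
    show ?thesis by (simp add: algebra_simps)
  qed
  have p: "p = (\<Sum>m\<in>Poly_Mapping.keys p. ?c m)" by (rule poly_eq_sum_monomials)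
  have "hcomp j (p * q) = hcomp j (\<Sum>m\<in>Poly_Mapping.keys p. ?c m * q)"
    by (subst p) (simp add: sum_distrib_right)
  also have "\<dots> = (\<Sum>m\<in>Poly_Mapping.keys p. hcomp (j - e) (?c m)) * q"
    by (simp add: hcomp_sum mono sum_distrib_right)
  also have "\<dots> = hcomp (j - e) p * q"
    by (subst (2) p) (simp add: hcomp_sum)
  finally show ?thesis .
qed

lemma const_term_mult:
  fixes p q :: "('v, 'k::field) mpoly"
  shows "Poly_Mapping.lookup (p * q) 0 = Poly_Mapping.lookup p 0 * Poly_Mapping.lookup q 0"
proof -
  let ?c = "\<lambda>m. Poly_Mapping.single m (Poly_Mapping.lookup p m)"
  have mono: "Poly_Mapping.lookup (?c m * q) 0 =
      (if m = 0 then Poly_Mapping.lookup p 0 * Poly_Mapping.lookup q 0 else 0)" for m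
  proof (cases "m = 0")
    case True
    then show ?thesis using lookup_single_mult[of 0 _ q 0] by simp
  next
    case False
    then have "0 \<notin> Poly_Mapping.keys (?c m * q)"
      using keys_mult[of "?c m" q] by (auto simp: monomial_add_eq_0_iff split: if_splits)
    then show ?thesis using False by (simp add: in_keys_iff)
  qed
  have "p * q = (\<Sum>m\<in>Poly_Mapping.keys p. ?c m * q)"
    by (subst poly_eq_sum_monomials[of p]) (simp add: sum_distrib_right)
  then have "Poly_Mapping.lookup (p * q) 0 =
      (\<Sum>m\<in>Poly_Mapping.keys p. if m = 0 then Poly_Mapping.lookup p 0 * Poly_Mapping.lookup q 0 else 0)"
    by (simp add: lookup_sum mono)
  also have "\<dots> = Poly_Mapping.lookup p 0 * Poly_Mapping.lookup q 0"
    by (auto simp: in_keys_iff)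
  finally show ?thesis .
qed

text \<open>
  Membership in an ideal generated by monomials can be tested term by term: group the terms of
  \<open>p\<close> by a generator that divides them.
\<close>

lemma monomial_decomposition:
  fixes p :: "('v, 'k::field) mpoly" and b :: "nat \<Rightarrow> ('v \<Rightarrow>\<^sub>0 nat)"
  assumes p: "p \<in> polys V"
    and div: "\<And>m. m \<in> Poly_Mapping.keys p \<Longrightarrow> \<exists>i<n. \<exists>m'. m = m' + b i"
  shows "\<exists>c. (\<forall>i. c i \<in> polys V) \<and> p = (\<Sum>i<n. c i * monomial (b i))"
proof -
  have "\<exists>c. (\<forall>i. c i \<in> polys V) \<and>
      Poly_Mapping.single m (Poly_Mapping.lookup p m) = (\<Sum>i<n. c i * monomial (b i))"
    if m: "m \<in> Poly_Mapping.keys p" for m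
  proof -
    from div[OF m] obtain i m' where i: "i < n" "m = m' + b i" by blast
    let ?t = "Poly_Mapping.single m' (Poly_Mapping.lookup p m) :: ('v, 'k) mpoly"
    let ?c = "\<lambda>j. if j = i then ?t else 0"
    have "Poly_Mapping.keys m' \<subseteq> V" using p m i(2) by (fastforce simp: polys_def keys_add_nat)
    then have "\<forall>j. ?c j \<in> polys V" by (simp add: polys_single)
    moreover have "(\<Sum>j<n. ?c j * monomial (b j)) = ?t * monomial (b i)"
      using i(1) by (simp add: if_distrib[of "\<lambda>x. x * _"] cong: if_cong)
    moreover have "?t * monomial (b i) = Poly_Mapping.single m (Poly_Mapping.lookup p m)"
      by (simp add: mult_single i(2))
    ultimately show ?thesis by (intro exI[of _ ?c]) simp
  qed
  then have "\<forall>m\<in>Poly_Mapping.keys p. \<exists>c. (\<forall>i. c i \<in> polys V) \<and>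
      Poly_Mapping.single m (Poly_Mapping.lookup p m) = (\<Sum>i<n. c i * monomial (b i))" by blast
  from bchoice[OF this] obtain C where C: "\<And>m i. m \<in> Poly_Mapping.keys p \<Longrightarrow> C m i \<in> polys V"
    "\<And>m. m \<in> Poly_Mapping.keys p \<Longrightarrow>
      Poly_Mapping.single m (Poly_Mapping.lookup p m) = (\<Sum>i<n. C m i * monomial (b i))"
    by blast
  define c where "c i = (\<Sum>m\<in>Poly_Mapping.keys p. C m i)" for i
  have "p = (\<Sum>m\<in>Poly_Mapping.keys p. \<Sum>i<n. C m i * monomial (b i))"
    by (subst poly_eq_sum_monomials) (simp add: C(2))
  also have "\<dots> = (\<Sum>i<n. c i * monomial (b i))"
    by (subst sum.swap) (simp add: c_def sum_distrib_right)
  finally have "p = (\<Sum>i<n. c i * monomial (b i))" .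
  moreover have "c i \<in> polys V" for i unfolding c_def by (rule polys_sum) (rule C(1))
  ultimately show ?thesis by blast
qed

text \<open>
  On polynomials this is membership in the ideal generated by the variables in \<open>X\<close>, stated
  through divisibility of the terms so that closure properties and cancellation are immediate.
\<close>

definition var_ideal :: "'v set \<Rightarrow> ('v, 'k::field) mpoly set" where
  "var_ideal X = {p. \<forall>m\<in>Poly_Mapping.keys p. Poly_Mapping.keys m \<inter> X \<noteq> {}}"

lemma var_ideal_0 [simp]: "0 \<in> var_ideal X"
  by (simp add: var_ideal_def)

lemma var_ideal_mvar: "x \<in> X \<Longrightarrow> mvar x \<in> var_ideal X"
  by (simp add: var_ideal_def mvar_def)

lemma var_ideal_mult:
  assumes "q \<in> var_ideal X" shows "p * q \<in> var_ideal X"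
  unfolding var_ideal_def
proof (rule CollectI, rule ballI)
  fix m assume "m \<in> Poly_Mapping.keys (p * q)"
  then obtain a b where "m = a + b" "b \<in> Poly_Mapping.keys q"
    using keys_mult[of p q] by blast
  then show "Poly_Mapping.keys m \<inter> X \<noteq> {}"
    using assms unfolding var_ideal_def by (auto simp: keys_add_nat)
qed

lemma var_ideal_sum:
  assumes "\<And>i. i \<in> A \<Longrightarrow> f i \<in> var_ideal X" shows "(\<Sum>i\<in>A. f i) \<in> var_ideal X"
  unfolding var_ideal_def
proof (rule CollectI, rule ballI)
  fix m assume "m \<in> Poly_Mapping.keys (\<Sum>i\<in>A. f i)"
  then obtain i where "i \<in> A" "m \<in> Poly_Mapping.keys (f i)"
    using keys_sum_subset[of f A] by blast
  then show "Poly_Mapping.keys m \<inter> X \<noteq> {}"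
    using assms unfolding var_ideal_def by blast
qed

text \<open>
  The quotient by an ideal generated by variables is a polynomial ring, in which the remaining
  variables are no zero divisors.
\<close>

lemma var_ideal_cancel:
  assumes "p * mvar x \<in> var_ideal X" "x \<notin> X" shows "p \<in> var_ideal X"
  unfolding var_ideal_def
proof clarify
  fix m assume "m \<in> Poly_Mapping.keys p" and e: "Poly_Mapping.keys m \<inter> X = {}"
  then have "m + Poly_Mapping.single x 1 \<in> Poly_Mapping.keys (p * mvar x)"
    unfolding mvar_def by (intro keys_mult_single) auto
  then have "Poly_Mapping.keys (m + Poly_Mapping.single x 1) \<inter> X \<noteq> {}"
    using assms(1) unfolding var_ideal_def by blast
  then show False using assms(2) e by (auto simp: keys_add_nat)
qed

lemma var_ideal_decomposition:
  assumes "p \<in> polys V" "p \<in> var_ideal (set xs)"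
  shows "\<exists>c. (\<forall>i. c i \<in> polys V) \<and> p = (\<Sum>i<length xs. c i * mvar (xs ! i))"
  unfolding mvar_def
proof (rule monomial_decomposition[OF assms(1)])
  fix m assume "m \<in> Poly_Mapping.keys p"
  then obtain x where x: "x \<in> Poly_Mapping.keys m" "x \<in> set xs" using assms(2) by (auto simp: var_ideal_def)
  then obtain i where i: "i < length xs" "xs ! i = x" by (auto simp: in_set_conv_nth)
  have "\<forall>v. Poly_Mapping.lookup (Poly_Mapping.single x 1) v \<le> Poly_Mapping.lookup m v"
    using x(1) by (auto simp: lookup_single when_def in_keys_iff)
  then obtain c where "m = Poly_Mapping.single x 1 + c" by (auto simp flip: monomial_divides_iff)
  then show "\<exists>i<length xs. \<exists>m'. m = m' + Poly_Mapping.single (xs ! i) 1"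
    using i by (metis add.commute)
qed


section \<open>Linear quotients and their syzygies\<close>

text \<open>
  A vector is a function of its coordinate, and \<open>m s\<close> is the \<open>s\<close>-th vector of a family.  The
  number of coordinates is left open; vectors with finitely many coordinates are zero beyond
  them.  So families of different lengths and ranks share one type, as iteration requires.
\<close>

definition spans :: "'v set \<Rightarrow> (nat \<Rightarrow> nat \<Rightarrow> ('v, 'k::field) mpoly) \<Rightarrow> nat \<Rightarrow> (nat \<Rightarrow> ('v, 'k) mpoly) set" where
  "spans V m n = {w. \<exists>u. (\<forall>t. u t \<in> polys V) \<and> (\<forall>c. w c = (\<Sum>t<n. u t * m t c))}"

definition syzygies :: "'v set \<Rightarrow> (nat \<Rightarrow> nat \<Rightarrow> ('v, 'k::field) mpoly) \<Rightarrow> nat \<Rightarrow> (nat \<Rightarrow> ('v, 'k) mpoly) set" where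
  "syzygies V m n = {v. (\<forall>t. v t \<in> polys V) \<and> (\<forall>t\<ge>n. v t = 0) \<and> (\<forall>c. (\<Sum>t<n. v t * m t c) = 0)}"

text \<open>
  The colon ideal of each vector modulo its predecessors is generated by variables.
\<close>

definition linear_quotients :: "'v set \<Rightarrow> (nat \<Rightarrow> nat \<Rightarrow> ('v, 'k::field) mpoly) \<Rightarrow> nat \<Rightarrow> bool" where
  "linear_quotients V m n \<longleftrightarrow>
     (\<forall>s<n. \<exists>X\<subseteq>V. \<forall>p\<in>polys V. (\<lambda>c. p * m s c) \<in> spans V m s \<longleftrightarrow> p \<in> var_ideal X)"

lemma spansI: "(\<And>t. u t \<in> polys V) \<Longrightarrow> (\<And>c. w c = (\<Sum>t<n. u t * m t c)) \<Longrightarrow> w \<in> spans V m n"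
  unfolding spans_def by blast

lemma spansE:
  assumes "w \<in> spans V m n"
  obtains u where "\<And>t. u t \<in> polys V" "\<And>c. w c = (\<Sum>t<n. u t * m t c)"
  using assms unfolding spans_def by blast

lemma spans_cong: "(\<And>s. s < n \<Longrightarrow> m s = m' s) \<Longrightarrow> spans V m n = spans V m' n"
  unfolding spans_def by (intro Collect_cong ex_cong1 conj_cong refl all_cong1) simp

lemma generator_in_spans:
  assumes "s < n" shows "m s \<in> spans V m n"
proof (rule spansI)
  show "(if t = s then 1 else 0) \<in> polys V" for t by simp
  show "m s c = (\<Sum>t<n. (if t = s then 1 else 0) * m t c)" for c
  proof -
    have "(\<Sum>t<n. (if t = s then 1 else 0) * m t c) = (\<Sum>t<n. if t = s then m s c else 0)"
      by (rule sum.cong) auto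
    then show ?thesis using assms by simp
  qed
qed

lemma syzygies_minus_combination:
  assumes v: "v \<in> syzygies V m n"
    and w: "\<And>i. i \<in> A \<Longrightarrow> w i \<in> syzygies V m n" and p: "\<And>i. i \<in> A \<Longrightarrow> p i \<in> polys V"
  shows "(\<lambda>t. v t - (\<Sum>i\<in>A. p i * w i t)) \<in> syzygies V m n"
proof -
  have "(\<Sum>t<n. (v t - (\<Sum>i\<in>A. p i * w i t)) * m t c) = 0" for c
  proof -
    have "(\<Sum>t<n. (v t - (\<Sum>i\<in>A. p i * w i t)) * m t c) =
        (\<Sum>t<n. v t * m t c) - (\<Sum>t<n. \<Sum>i\<in>A. p i * (w i t * m t c))"
      by (simp add: left_diff_distrib sum_subtractf sum_distrib_right mult.assoc)
    also have "(\<Sum>t<n. \<Sum>i\<in>A. p i * (w i t * m t c)) = (\<Sum>i\<in>A. p i * (\<Sum>t<n. w i t * m t c))"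
      by (subst sum.swap) (simp add: sum_distrib_left)
    also have "\<dots> = 0" using w by (intro sum.neutral) (simp add: syzygies_def)
    finally show ?thesis using v by (simp add: syzygies_def)
  qed
  moreover have "v t - (\<Sum>i\<in>A. p i * w i t) \<in> polys V" for t
    using v w p by (intro polys_diff polys_sum polys_mult) (auto simp: syzygies_def)
  moreover have "v t - (\<Sum>i\<in>A. p i * w i t) = 0" if "t \<ge> n" for t
  proof -
    have "(\<Sum>i\<in>A. p i * w i t) = 0" using w that by (intro sum.neutral) (simp add: syzygies_def)
    then show ?thesis using v that by (simp add: syzygies_def)
  qed
  ultimately show ?thesis unfolding syzygies_def by blast
qed

lemma syzygies_0 [simp]: "(\<lambda>t. 0) \<in> syzygies V m n"
  by (simp add: syzygies_def)

lemma spans_subset_syzygies: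
  assumes "\<And>s. s < n' \<Longrightarrow> m' s \<in> syzygies V m n"
  shows "spans V m' n' \<subseteq> syzygies V m n"
proof
  fix w assume "w \<in> spans V m' n'"
  then obtain u where u: "\<And>t. u t \<in> polys V" "\<And>c. w c = (\<Sum>t<n'. u t * m' t c)"
    by (rule spansE) blast
  have "(\<lambda>t. 0 - (\<Sum>i\<in>{..<n'}. (- u i) * m' i t)) \<in> syzygies V m n"
    using assms u(1) by (intro syzygies_minus_combination) (auto intro: polys_uminus)
  also have "(\<lambda>t. 0 - (\<Sum>i\<in>{..<n'}. (- u i) * m' i t)) = w"
    by (auto simp: u(2) sum_negf)
  finally show "w \<in> syzygies V m n" .
qed

lemma sum_lessThan_append:
  fixes f :: "nat \<Rightarrow> 'a::comm_monoid_add"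
  shows "(\<Sum>s<n + k. f s) = (\<Sum>s<n. f s) + (\<Sum>i<k. f (n + i))"
  by (induction k) (simp_all add: add.assoc)

text \<open>
  Let \<open>X\<close> be the variables that generate the colon ideal of the last vector \<open>m q\<close>.  Each \<open>x \<in> X\<close>
  gives a syzygy with last coordinate \<open>x\<close>, whose other coordinates may be taken linear because
  the equation is homogeneous.  The last coordinate of any syzygy lies in the ideal of \<open>X\<close>, so these
  syzygies together with those of the shorter family generate all syzygies.  For the colon
  ideals of the new family let \<open>x\<^sub>0, x\<^sub>1, \<dots>\<close> enumerate \<open>X\<close>.  If a multiple \<open>p \<sigma>\<^sub>i\<close> depends on the
  predecessors, comparing last coordinates gives \<open>p x\<^sub>i \<in> (x\<^sub>0, \<dots>, x\<^sub>i\<^sub>-\<^sub>1)\<close> and hence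
  \<open>p \<in> (x\<^sub>0, \<dots>, x\<^sub>i\<^sub>-\<^sub>1)\<close>.  Conversely \<open>x\<^sub>j \<sigma>\<^sub>i - x\<^sub>i \<sigma>\<^sub>j\<close> has last coordinate zero, so it is a syzygy of
  the shorter family.
\<close>

theorem syzygies_of_linear_quotients:
  fixes m :: "nat \<Rightarrow> nat \<Rightarrow> ('v, 'k::field) mpoly"
  assumes "finite V" and "linear_quotients V m n"
    and "\<And>s c. s < n \<Longrightarrow> m s c \<in> polys V" and "\<And>s c. s < n \<Longrightarrow> homogeneous \<delta> (m s c)"
  shows "\<exists>n' m'. linear_quotients V m' n' \<and>
    (\<forall>s<n'. \<forall>c. m' s c \<in> polys V \<and> homogeneous 1 (m' s c)) \<and> syzygies V m n = spans V m' n'"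
  using assms(2-)
proof (induction n)
  case 0
  have "\<exists>u. \<forall>t::nat. u t \<in> polys V" by (rule exI[of _ "\<lambda>_. 0"]) simp
  then have "syzygies V m 0 = spans V (\<lambda>_ _. 0) 0"
    by (auto simp: syzygies_def spans_def)
  then show ?case by (intro exI[of _ 0] exI[of _ "\<lambda>_ _. 0"]) (simp add: linear_quotients_def)
next
  case (Suc q)
  have "linear_quotients V m q" using Suc.prems(1) by (simp add: linear_quotients_def)
  with Suc.IH Suc.prems(2,3) obtain q' and m' :: "nat \<Rightarrow> nat \<Rightarrow> ('v, 'k) mpoly" where
    lq': "linear_quotients V m' q'"
    and m': "\<And>s c. s < q' \<Longrightarrow> m' s c \<in> polys V" "\<And>s c. s < q' \<Longrightarrow> homogeneous 1 (m' s c)"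
    and syz': "syzygies V m q = spans V m' q'"
    by (metis less_Suc_eq)
  have "\<exists>X\<subseteq>V. \<forall>p\<in>polys V. (\<lambda>c. p * m q c) \<in> spans V m q \<longleftrightarrow> p \<in> var_ideal X"
    using Suc.prems(1) unfolding linear_quotients_def by simp
  then obtain X where X: "X \<subseteq> V"
    and colon': "\<forall>p\<in>polys V. (\<lambda>c. p * m q c) \<in> spans V m q \<longleftrightarrow> p \<in> var_ideal X"
    by (elim exE conjE)
  note colon = bspec[OF colon']
  from X assms(1) have "finite X" by (rule finite_subset)
  then obtain xs where xs: "set xs = X" "distinct xs" using finite_distinct_list by blast
  define k where "k = length xs"
  have xsV: "xs ! i \<in> V" if "i < k" for i using that xs(1) X nth_mem unfolding k_def by blast
  have "\<forall>i. \<exists>u. i < k \<longrightarrow> (\<forall>t. u t \<in> polys V \<and> homogeneous 1 (u t)) \<and>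
      (\<forall>c. mvar (xs ! i) * m q c = (\<Sum>t<q. u t * m t c))"
  proof
    fix i
    show "\<exists>u. i < k \<longrightarrow> (\<forall>t. u t \<in> polys V \<and> homogeneous 1 (u t)) \<and>
      (\<forall>c. mvar (xs ! i) * m q c = (\<Sum>t<q. u t * m t c))"
    proof (cases "i < k")
      case i: True
      have "mvar (xs ! i) \<in> var_ideal X"
        using i xs(1) unfolding k_def by (intro var_ideal_mvar) auto
      then have "(\<lambda>c. mvar (xs ! i) * m q c) \<in> spans V m q"
        using colon[OF polys_mvar[OF xsV[OF i]]] by simp
      then obtain u where u: "\<And>t. u t \<in> polys V"
        "\<And>c. mvar (xs ! i) * m q c = (\<Sum>t<q. u t * m t c)"
        by (rule spansE) blast
      have "mvar (xs ! i) * m q c = (\<Sum>t<q. hcomp 1 (u t) * m t c)" for c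
      proof -
        have "homogeneous (1 + \<delta>) (mvar (xs ! i) * m q c)"
          by (intro homogeneous_mult Suc.prems(3)) simp_all
        then have "mvar (xs ! i) * m q c = hcomp (1 + \<delta>) (mvar (xs ! i) * m q c)"
          by (simp add: hcomp_homogeneous)
        also have "\<dots> = (\<Sum>t<q. hcomp (1 + \<delta>) (u t * m t c))" by (simp add: u(2) hcomp_sum)
        also have "\<dots> = (\<Sum>t<q. hcomp 1 (u t) * m t c)"
          using Suc.prems(3) by (intro sum.cong refl) (subst hcomp_mult[where e = \<delta>], auto)
        finally show ?thesis .
      qed
      then show ?thesis using u(1)
        by (intro exI[of _ "\<lambda>t. hcomp 1 (u t)"]) (auto intro: hcomp_polys homogeneous_hcomp)
    qed auto
  qed
  from choice[OF this] obtain C where C: "\<And>i t. i < k \<Longrightarrow> C i t \<in> polys V"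
    "\<And>i t. i < k \<Longrightarrow> homogeneous 1 (C i t)"
    "\<And>i c. i < k \<Longrightarrow> mvar (xs ! i) * m q c = (\<Sum>t<q. C i t * m t c)"
    by blast
  \<comment> \<open>the syzygy with last coordinate \<open>x\<^sub>i\<close>\<close>
  define \<sigma> where "\<sigma> i t = (if t < q then - C i t else if t = q then mvar (xs ! i) else 0)" for i t
  have \<sigma>q: "\<sigma> i q = mvar (xs ! i)" for i by (simp add: \<sigma>_def)
  have \<sigma>_polys: "\<sigma> i t \<in> polys V" if "i < k" for i t
    using that C(1) xsV by (auto simp: \<sigma>_def intro: polys_closed)
  have \<sigma>_hom: "homogeneous 1 (\<sigma> i t)" if "i < k" for i t
    using that C(2) by (auto simp: \<sigma>_def intro: homogeneous_uminus)
  have \<sigma>_syz: "\<sigma> i \<in> syzygies V m (Suc q)" if i: "i < k" for i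
  proof -
    have "(\<Sum>t<Suc q. \<sigma> i t * m t c) = 0" for c
      by (simp add: \<sigma>_def sum_negf C(3)[OF i])
    then show ?thesis using \<sigma>_polys[OF i] by (auto simp: syzygies_def \<sigma>_def)
  qed
  have last0: "w \<in> spans V m' q'" if "w \<in> syzygies V m (Suc q)" "w q = 0" for w
  proof -
    have "w \<in> syzygies V m q"
    proof -
      note w = that
      have "w t = 0" if t: "t \<ge> q" for t
      proof (cases "t = q")
        case False
        then have "t \<ge> Suc q" using t by simp
        then show ?thesis using w(1) by (simp add: syzygies_def)
      qed (simp add: w)
      then show ?thesis using w by (simp add: syzygies_def)
    qed
    then show ?thesis by (simp add: syz')
  qed
  have syz_Suc: "w \<in> syzygies V m (Suc q)" if "w \<in> syzygies V m q" for w
    using that by (auto simp: syzygies_def)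
  \<comment> \<open>the syzygies of the shorter family come first, so that its colon ideals are unchanged\<close>
  define m'' where "m'' s = (if s < q' then m' s else \<sigma> (s - q'))" for s
  have m''_simps: "s < q' \<Longrightarrow> m'' s = m' s" "m'' (q' + i) = \<sigma> i" for s i
    by (simp_all add: m''_def)
  have sum'': "(\<Sum>s<q' + i. u s * m'' s c) =
      (\<Sum>s<q'. u s * m' s c) + (\<Sum>j<i. u (q' + j) * \<sigma> j c)" for u i c
    by (simp add: sum_lessThan_append m''_simps)
  have span'': "w \<in> spans V m'' (q' + i)"
    if w0: "(\<lambda>c. w c - (\<Sum>j<i. p j * \<sigma> j c)) \<in> spans V m' q'" and p: "\<And>j. p j \<in> polys V" for w i p
  proof -
    from w0 obtain u where u: "\<And>t. u t \<in> polys V"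
      "\<And>c. w c - (\<Sum>j<i. p j * \<sigma> j c) = (\<Sum>t<q'. u t * m' t c)"
      by (rule spansE) blast
    show ?thesis
    proof (rule spansI)
      show "(if s < q' then u s else p (s - q')) \<in> polys V" for s using u(1) p by simp
      show "w c = (\<Sum>s<q' + i. (if s < q' then u s else p (s - q')) * m'' s c)" for c
        using u(2)[of c] unfolding sum'' by (simp add: algebra_simps)
    qed
  qed
  have m'_syz: "m' s \<in> syzygies V m q" if "s < q'" for s
    using generator_in_spans[OF that] by (simp add: syz')
  have m''_syz: "m'' s \<in> syzygies V m (Suc q)" if "s < q' + k" for s
    using that m'_syz syz_Suc \<sigma>_syz[of "s - q'"] by (auto simp: m''_def)
  have "syzygies V m (Suc q) = spans V m'' (q' + k)"
  proof
    show "spans V m'' (q' + k) \<subseteq> syzygies V m (Suc q)"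
      by (rule spans_subset_syzygies) (rule m''_syz)
    show "syzygies V m (Suc q) \<subseteq> spans V m'' (q' + k)"
    proof
      fix v assume v: "v \<in> syzygies V m (Suc q)"
      then have vp: "v t \<in> polys V" for t by (simp add: syzygies_def)
      have "v q * m q c = (\<Sum>t<q. (- v t) * m t c)" for c
      proof -
        have "(\<Sum>t<q. v t * m t c) + v q * m q c = 0" using v by (simp add: syzygies_def)
        then have "v q * m q c = - (\<Sum>t<q. v t * m t c)" by (metis add.commute eq_neg_iff_add_eq_0)
        then show ?thesis by (simp add: sum_negf)
      qed
      then have "(\<lambda>c. v q * m q c) \<in> spans V m q"
        by (intro spansI[where u = "\<lambda>t. - v t"]) (auto intro: polys_uminus vp)
      then have "v q \<in> var_ideal (set xs)" using colon[OF vp] xs(1) by simp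
      from var_ideal_decomposition[OF vp this] obtain p where
        p: "\<And>i. p i \<in> polys V" "v q = (\<Sum>i<k. p i * mvar (xs ! i))" unfolding k_def by blast
      show "v \<in> spans V m'' (q' + k)"
      proof (rule span''[where p = p])
        show "(\<lambda>c. v c - (\<Sum>j<k. p j * \<sigma> j c)) \<in> spans V m' q'"
        proof (rule last0)
          show "(\<lambda>c. v c - (\<Sum>j<k. p j * \<sigma> j c)) \<in> syzygies V m (Suc q)"
            using v p(1) \<sigma>_syz by (intro syzygies_minus_combination) auto
          show "v q - (\<Sum>j<k. p j * \<sigma> j q) = 0" by (simp add: \<sigma>q p(2))
        qed
      qed (rule p(1))
    qed
  qed
  moreover have "linear_quotients V m'' (q' + k)"
    unfolding linear_quotients_def
  proof (intro allI impI)
    fix s assume s: "s < q' + k"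
    show "\<exists>X\<subseteq>V. \<forall>p\<in>polys V. (\<lambda>c. p * m'' s c) \<in> spans V m'' s \<longleftrightarrow> p \<in> var_ideal X"
    proof (cases "s < q'")
      case True
      then have "spans V m'' s = spans V m' s" by (intro spans_cong) (simp add: m''_simps)
      then show ?thesis using lq' True unfolding linear_quotients_def by (simp add: m''_simps)
    next
      case False
      then obtain i where i: "s = q' + i" "i < k" using s by (metis add_less_cancel_left le_Suc_ex not_le)
      let ?Y = "set (take i xs)"
      have "(\<lambda>c. p * m'' s c) \<in> spans V m'' s \<longleftrightarrow> p \<in> var_ideal ?Y" if p: "p \<in> polys V" for p
      proof
        assume "(\<lambda>c. p * m'' s c) \<in> spans V m'' s"
        then obtain u where u: "\<And>c. p * m'' s c = (\<Sum>t<q' + i. u t * m'' t c)"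
          unfolding i(1) by (rule spansE) blast
        have "p * mvar (xs ! i) = (\<Sum>t<q'. u t * m' t q) + (\<Sum>j<i. u (q' + j) * \<sigma> j q)"
          using u[of q] unfolding sum'' by (simp add: i(1) m''_simps \<sigma>q)
        also have "(\<Sum>t<q'. u t * m' t q) = 0"
          using m'_syz by (intro sum.neutral) (simp add: syzygies_def)
        finally have e: "p * mvar (xs ! i) = (\<Sum>j<i. u (q' + j) * mvar (xs ! j))" by (simp add: \<sigma>q)
        have "mvar (xs ! j) \<in> var_ideal ?Y" if "j < i" for j
          using that i(2) unfolding k_def
          by (intro var_ideal_mvar) (metis in_set_conv_nth length_take min.absorb4 nth_take)
        then have "p * mvar (xs ! i) \<in> var_ideal ?Y"
          unfolding e by (intro var_ideal_sum var_ideal_mult) auto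
        moreover have "xs ! i \<notin> ?Y"
          using xs(2) i(2) unfolding k_def by (auto simp: in_set_conv_nth nth_eq_iff_index_eq)
        ultimately show "p \<in> var_ideal ?Y" by (rule var_ideal_cancel)
      next
        assume "p \<in> var_ideal ?Y"
        from var_ideal_decomposition[OF p this] obtain d where
          d: "\<And>j. d j \<in> polys V" and "p = (\<Sum>j<length (take i xs). d j * mvar (take i xs ! j))"
          by blast
        then have d2: "p = (\<Sum>j<i. d j * mvar (xs ! j))"
          using i(2) unfolding k_def by simp
        have dx: "d j * mvar (xs ! i) \<in> polys V" for j
          using d polys_mvar[OF xsV[OF i(2)]] by (rule polys_mult)
        show "(\<lambda>c. p * m'' s c) \<in> spans V m'' s"
          unfolding i(1)
        proof (rule span''[where p = "\<lambda>j. d j * mvar (xs ! i)"])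
          show "(\<lambda>c. p * m'' (q' + i) c - (\<Sum>j<i. d j * mvar (xs ! i) * \<sigma> j c)) \<in> spans V m' q'"
          proof (rule last0)
            have 1: "(\<lambda>c. p * \<sigma> i c) \<in> syzygies V m (Suc q)"
              using syzygies_minus_combination[of "\<lambda>_. 0" V m "Suc q" "{i}" \<sigma> "\<lambda>_. - p"]
                \<sigma>_syz[OF i(2)] p by (simp add: polys_uminus)
            show "(\<lambda>c. p * m'' (q' + i) c - (\<Sum>j<i. d j * mvar (xs ! i) * \<sigma> j c)) \<in> syzygies V m (Suc q)"
              unfolding m''_simps using 1 dx \<sigma>_syz i(2)
              by (intro syzygies_minus_combination) auto
            show "p * m'' (q' + i) q - (\<Sum>j<i. d j * mvar (xs ! i) * \<sigma> j q) = 0"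
              by (simp add: m''_simps \<sigma>q d2 sum_distrib_right mult.assoc mult.commute[of "mvar (xs ! i)"])
          qed
        qed (rule dx)
      qed
      moreover have "?Y \<subseteq> V" using set_take_subset[of i xs] xs(1) X by blast
      ultimately show ?thesis by (intro exI[of _ ?Y]) simp
    qed
  qed
  moreover have "m'' s c \<in> polys V \<and> homogeneous 1 (m'' s c)" if "s < q' + k" for s c
    using that m' \<sigma>_polys[of "s - q'"] \<sigma>_hom[of "s - q'"] by (auto simp: m''_def)
  ultimately show ?case by (intro exI[of _ "q' + k"] exI[of _ m'']) simp
qed


section \<open>The linear resolution of a family with linear quotients\<close>

lemma free_module_mult_mat_vec:
  fixes A :: "('v, 'k::field) mpoly mat"
  assumes A: "A \<in> carrier_mat r c" "\<And>i j. i < r \<Longrightarrow> j < c \<Longrightarrow> A $$ (i, j) \<in> polys V"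
    and v: "v \<in> free_module V c"
  shows "A *\<^sub>v v \<in> free_module V r"
  unfolding free_module_def
proof (intro CollectI conjI allI impI)
  show "A *\<^sub>v v \<in> carrier_vec r" using A(1) v by (simp add: free_module_def)
  fix i assume "i < r"
  then show "(A *\<^sub>v v) $ i \<in> polys V"
    using A v by (auto simp: scalar_prod_def free_module_def intro!: polys_sum polys_mult)
qed

text \<open>
  Iterate \<open>syzygies_of_linear_quotients\<close>.  All entries after the first step are linear forms, so the
  generators of the \<open>i\<close>-th module have degree \<open>i + d\<close>.
\<close>

theorem linear_quotients_imp_linear_resolution:
  fixes m :: "nat \<Rightarrow> nat \<Rightarrow> ('v, 'k::field) mpoly"
  assumes V: "finite V" and lq: "linear_quotients V m n"
    and m_polys: "\<And>s c. s < n \<Longrightarrow> m s c \<in> polys V" and m_hom: "\<And>s c. s < n \<Longrightarrow> homogeneous d (m s c)"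
    and m_ideal: "\<And>s c. c \<noteq> 0 \<Longrightarrow> m s c = 0"
  shows "\<exists>F. graded_free_resolution V {w 0 |w. w \<in> spans V m n} F \<and>
    (\<forall>i. \<forall>c < rk F i. degs F i ! c = int i + d)"
proof -
  define P :: "nat \<Rightarrow> nat \<times> (nat \<Rightarrow> nat \<Rightarrow> ('v, 'k) mpoly) \<Rightarrow> bool" where
    "P i x \<longleftrightarrow> linear_quotients V (snd x) (fst x) \<and> (i = 0 \<longrightarrow> x = (n, m)) \<and>
      (\<forall>s<fst x. \<forall>c. snd x s c \<in> polys V \<and> homogeneous (if i = 0 then d else 1) (snd x s c))" for i x
  define Q :: "nat \<Rightarrow> nat \<times> (nat \<Rightarrow> nat \<Rightarrow> ('v, 'k) mpoly) \<Rightarrow> nat \<times> (nat \<Rightarrow> nat \<Rightarrow> ('v, 'k) mpoly) \<Rightarrow> bool" where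
    "Q i x y \<longleftrightarrow> syzygies V (snd x) (fst x) = spans V (snd y) (fst y)" for i x y
  have "\<exists>f. \<forall>i. P i (f i) \<and> Q i (f i) (f (Suc i))"
  proof (rule dependent_nat_choice)
    show "\<exists>x. P 0 x" using lq m_polys m_hom by (intro exI[of _ "(n, m)"]) (simp add: P_def)
  next
    fix x i assume "P i x"
    then have "linear_quotients V (snd x) (fst x)"
      "\<And>s c. s < fst x \<Longrightarrow> snd x s c \<in> polys V"
      "\<And>s c. s < fst x \<Longrightarrow> homogeneous (if i = 0 then d else 1) (snd x s c)"
      by (simp_all add: P_def)
    from syzygies_of_linear_quotients[OF V this] obtain n' and m' :: "nat \<Rightarrow> nat \<Rightarrow> ('v, 'k) mpoly"
      where "linear_quotients V m' n'" "\<forall>s<n'. \<forall>c. m' s c \<in> polys V \<and> homogeneous 1 (m' s c)"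
        "syzygies V (snd x) (fst x) = spans V m' n'" by blast
    then show "\<exists>y. P (Suc i) y \<and> Q i x y"
      by (intro exI[of _ "(n', m')"]) (simp add: P_def Q_def)
  qed
  then obtain f where f: "\<And>i. P i (f i)" "\<And>i. Q i (f i) (f (Suc i))" by blast
  define q where "q i = fst (f i)" for i
  define g where "g i = snd (f i)" for i
  have g0: "q 0 = n" "g 0 = m" using f(1)[of 0] by (simp_all add: P_def q_def g_def)
  have g_polys: "g i s c \<in> polys V" if "s < q i" for i s c
    using f(1)[of i] that by (simp add: P_def q_def g_def)
  have g_hom: "homogeneous 1 (g (Suc i) s c)" if "s < q (Suc i)" for i s c
    using f(1)[of "Suc i"] that by (simp add: P_def q_def g_def)
  have syz: "syzygies V (g i) (q i) = spans V (g (Suc i)) (q (Suc i))" for i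
    using f(2)[of i] by (simp add: Q_def q_def g_def)
  have g_syz: "g (Suc i) s \<in> syzygies V (g i) (q i)" if "s < q (Suc i)" for i s
    using generator_in_spans[OF that] by (simp add: syz)
  define F :: "('v, 'k) free_complex" where
    "F = \<lparr>degs = (\<lambda>i. replicate (q i) (int i + d)),
          bd = (\<lambda>i. mat (q i) (q (Suc i)) (\<lambda>(r, c). g (Suc i) c r)),
          aug = vec (q 0) (\<lambda>s. g 0 s 0)\<rparr>"
  have [simp]: "rk F i = q i" for i by (simp add: F_def)
  have degs: "c < q i \<Longrightarrow> degs F i ! c = int i + d" for i c by (simp add: F_def)
  have bd_carrier: "bd F i \<in> carrier_mat (q i) (q (Suc i))" for i by (simp add: F_def)
  have bd_entry: "r < q i \<Longrightarrow> c < q (Suc i) \<Longrightarrow> bd F i $$ (r, c) = g (Suc i) c r" for i r c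
    by (simp add: F_def)
  have bd_mult: "(bd F i *\<^sub>v w) $ r = (\<Sum>c<q (Suc i). w $ c * g (Suc i) c r)"
    if "w \<in> carrier_vec (q (Suc i))" "r < q i" for i w r
    using that by (simp add: F_def scalar_prod_def atLeast0LessThan mult.commute)
  have bd_free: "bd F i *\<^sub>v w \<in> free_module V (q i)" if "w \<in> free_module V (q (Suc i))" for i w
    using free_module_mult_mat_vec[OF bd_carrier _ that] by (simp add: bd_entry g_polys)
  have aug_mult: "aug F \<bullet> w = (\<Sum>c<q 0. w $ c * m c 0)" if "w \<in> carrier_vec (q 0)" for w
    using that by (simp add: F_def g0 scalar_prod_def atLeast0LessThan mult.commute)
  have exact: "(\<forall>c. (\<Sum>t<q i. v $ t * g i t c) = 0) \<longleftrightarrow> (\<exists>w\<in>free_module V (q (Suc i)). v = bd F i *\<^sub>v w)"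
    if v: "v \<in> free_module V (q i)" for v i
  proof
    assume z: "\<forall>c. (\<Sum>t<q i. v $ t * g i t c) = 0"
    let ?v = "\<lambda>t. if t < q i then v $ t else 0"
    have "?v \<in> syzygies V (g i) (q i)"
      using z v by (simp add: syzygies_def free_module_def)
    then obtain u where u: "\<And>t. u t \<in> polys V" "\<And>c. ?v c = (\<Sum>t<q (Suc i). u t * g (Suc i) t c)"
      unfolding syz by (rule spansE) blast
    let ?w = "vec (q (Suc i)) u"
    have "v = bd F i *\<^sub>v ?w"
    proof (rule eq_vecI)
      show "dim_vec v = dim_vec (bd F i *\<^sub>v ?w)" using v bd_carrier[of i] by (simp add: free_module_def)
      fix r assume "r < dim_vec (bd F i *\<^sub>v ?w)"
      then have r: "r < q i" using bd_carrier[of i] by simp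
      then show "v $ r = (bd F i *\<^sub>v ?w) $ r" using u(2)[of r] by (subst bd_mult) simp_all
    qed
    moreover have "?w \<in> free_module V (q (Suc i))" by (simp add: free_module_def u(1))
    ultimately show "\<exists>w\<in>free_module V (q (Suc i)). v = bd F i *\<^sub>v w" by (intro bexI[of _ ?w])
  next
    assume "\<exists>w\<in>free_module V (q (Suc i)). v = bd F i *\<^sub>v w"
    then obtain w where w: "w \<in> free_module V (q (Suc i))" "v = bd F i *\<^sub>v w" by blast
    then have wc: "w \<in> carrier_vec (q (Suc i))" by (simp add: free_module_def)
    let ?u = "\<lambda>c. if c < q (Suc i) then w $ c else 0"
    have "(\<lambda>r. \<Sum>c<q (Suc i). ?u c * g (Suc i) c r) \<in> syzygies V (g i) (q i)"
      unfolding syz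
      by (rule spansI[where u = ?u]) (use w(1) in \<open>simp_all add: free_module_def\<close>)
    then have *: "(\<Sum>t<q i. (\<Sum>c<q (Suc i). ?u c * g (Suc i) c t) * g i t e) = 0" for e
      by (simp add: syzygies_def)
    show "\<forall>c. (\<Sum>t<q i. v $ t * g i t c) = 0"
    proof
      fix e
      have "(\<Sum>t<q i. v $ t * g i t e) = (\<Sum>t<q i. (\<Sum>c<q (Suc i). ?u c * g (Suc i) c t) * g i t e)"
        unfolding w(2) by (intro sum.cong refl) (simp add: bd_mult[OF wc])
      then show "(\<Sum>t<q i. v $ t * g i t e) = 0" using * by simp
    qed
  qed
  have "graded_free_resolution V {w 0 |w. w \<in> spans V m n} F"
    unfolding graded_free_resolution_def \<open>\<And>i. rk F i = q i\<close>
  proof (intro conjI allI impI)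
    show "aug F \<in> free_module V (q 0)"
      using g_polys[of _ 0 0] by (simp add: F_def free_module_def)
    show "homogeneous (degs F 0 ! c) (aug F $ c)" if "c < q 0" for c
      using that m_hom by (simp add: F_def g0)
    show "bd F i \<in> carrier_mat (q i) (q (Suc i))" for i by (rule bd_carrier)
    show "bd F i $$ (r, c) \<in> polys V" if "r < q i" "c < q (Suc i)" for i r c
      using that by (simp add: bd_entry g_polys)
    show "homogeneous (degs F (Suc i) ! c - degs F i ! r) (bd F i $$ (r, c))"
      if "r < q i" "c < q (Suc i)" for i r c
      using that by (simp add: bd_entry degs g_hom)
    show "{aug F \<bullet> v |v. v \<in> free_module V (q 0)} = {w 0 |w. w \<in> spans V m n}"
    proof (intro equalityI subsetI)
      fix p assume "p \<in> {aug F \<bullet> v |v. v \<in> free_module V (q 0)}"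
      then obtain v where v: "v \<in> free_module V (q 0)" "p = aug F \<bullet> v" by blast
      let ?u = "\<lambda>c. if c < n then v $ c else 0"
      have "(\<lambda>r. \<Sum>c<n. ?u c * m c r) \<in> spans V m n"
        by (rule spansI[where u = ?u]) (use v(1) in \<open>simp_all add: free_module_def g0\<close>)
      moreover have "p = (\<Sum>c<n. ?u c * m c 0)"
        using v by (simp add: aug_mult free_module_def g0)
      ultimately show "p \<in> {w 0 |w. w \<in> spans V m n}"
        by (intro CollectI exI[of _ "\<lambda>r. \<Sum>c<n. ?u c * m c r"] conjI)
    next
      fix p assume "p \<in> {w 0 |w. w \<in> spans V m n}"
      then obtain w where w: "w \<in> spans V m n" "p = w 0" by auto
      from w(1) obtain u where u: "\<And>t. u t \<in> polys V" "\<And>c. w c = (\<Sum>t<n. u t * m t c)"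
        by (rule spansE) blast
      have "p = aug F \<bullet> vec (q 0) u" using w(2) u(2) by (subst aug_mult) (simp_all add: g0)
      moreover have "vec (q 0) u \<in> free_module V (q 0)" by (simp add: free_module_def u(1))
      ultimately show "p \<in> {aug F \<bullet> v |v. v \<in> free_module V (q 0)}" by blast
    qed
    have "(\<forall>c. (\<Sum>t<q 0. v $ t * g 0 t c) = 0) \<longleftrightarrow> aug F \<bullet> v = 0" if "v \<in> free_module V (q 0)" for v
    proof -
      have "(\<Sum>t<q 0. v $ t * g 0 t c) = 0" if "c \<noteq> 0" for c
        using that by (simp add: g0 m_ideal)
      moreover have "aug F \<bullet> v = (\<Sum>t<q 0. v $ t * g 0 t 0)"
        using that by (simp add: aug_mult g0 free_module_def)
      ultimately show ?thesis by (intro iffI allI) (simp, case_tac "c = 0", simp_all)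
    qed
    then show "{v \<in> free_module V (q 0). aug F \<bullet> v = 0} = {bd F 0 *\<^sub>v w |w. w \<in> free_module V (q 1)}"
      using exact[of _ 0] bd_free[of _ 0] unfolding One_nat_def by blast
    fix i
    have "(\<forall>c. (\<Sum>t<q (Suc i). v $ t * g (Suc i) t c) = 0) \<longleftrightarrow> bd F i *\<^sub>v v = 0\<^sub>v (q i)"
      if v: "v \<in> free_module V (q (Suc i))" for v
    proof -
      have vc: "v \<in> carrier_vec (q (Suc i))" using v by (simp add: free_module_def)
      have "(\<Sum>t<q (Suc i). v $ t * g (Suc i) t c) = 0" if "c \<ge> q i" for c
        using g_syz that by (intro sum.neutral) (simp add: syzygies_def)
      then have "(\<forall>c. (\<Sum>t<q (Suc i). v $ t * g (Suc i) t c) = 0) \<longleftrightarrow>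
          (\<forall>c<q i. (\<Sum>t<q (Suc i). v $ t * g (Suc i) t c) = 0)"
        by (intro iffI allI impI) (simp, case_tac "c < q i", simp_all)
      also have "\<dots> \<longleftrightarrow> bd F i *\<^sub>v v = 0\<^sub>v (q i)"
      proof
        assume "\<forall>c<q i. (\<Sum>t<q (Suc i). v $ t * g (Suc i) t c) = 0"
        then show "bd F i *\<^sub>v v = 0\<^sub>v (q i)"
          using bd_carrier[of i] by (intro eq_vecI) (simp_all add: bd_mult[OF vc] del: index_mult_mat_vec)
      next
        assume z: "bd F i *\<^sub>v v = 0\<^sub>v (q i)"
        show "\<forall>c<q i. (\<Sum>t<q (Suc i). v $ t * g (Suc i) t c) = 0"
        proof (intro allI impI)
          fix c assume "c < q i"
          with z show "(\<Sum>t<q (Suc i). v $ t * g (Suc i) t c) = 0"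
            by (simp flip: bd_mult[OF vc] del: index_mult_mat_vec)
        qed
      qed
      finally show ?thesis .
    qed
    then show "{v \<in> free_module V (q (Suc i)). bd F i *\<^sub>v v = 0\<^sub>v (q i)} =
        {bd F (Suc i) *\<^sub>v w |w. w \<in> free_module V (q (Suc (Suc i)))}"
      using exact[of _ "Suc i"] bd_free[of _ "Suc i"] by blast
  qed
  then show ?thesis using degs by (intro exI[of _ F]) simp
qed


section \<open>Comparison of graded free resolutions\<close>

text \<open>
  The matrices of degree preserving maps from the free module with generator degrees \<open>es\<close> to
  the one with generator degrees \<open>ds\<close>.
\<close>

definition graded_mat :: "'v set \<Rightarrow> int list \<Rightarrow> int list \<Rightarrow> ('v, 'k::field) mpoly mat \<Rightarrow> bool" where
  "graded_mat V ds es A \<longleftrightarrow> A \<in> carrier_mat (length ds) (length es) \<and>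
     (\<forall>r < length ds. \<forall>c < length es.
        A $$ (r, c) \<in> polys V \<and> homogeneous (es ! c - ds ! r) (A $$ (r, c)))"

lemma graded_mat_carrier: "graded_mat V ds es A \<Longrightarrow> A \<in> carrier_mat (length ds) (length es)"
  by (simp add: graded_mat_def)

lemma graded_mat_mult:
  assumes "graded_mat V ds es A" "graded_mat V es fs B"
  shows "graded_mat V ds fs (A * B)"
  unfolding graded_mat_def
proof (intro conjI allI impI)
  note A = graded_mat_carrier[OF assms(1)] and B = graded_mat_carrier[OF assms(2)]
  show "A * B \<in> carrier_mat (length ds) (length fs)" using A B by simp
  fix r c assume rc: "r < length ds" "c < length fs"
  have e: "(A * B) $$ (r, c) = (\<Sum>i<length es. A $$ (r, i) * B $$ (i, c))"
    using A B rc by (simp add: scalar_prod_def atLeast0LessThan)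
  show "(A * B) $$ (r, c) \<in> polys V"
    unfolding e using assms rc by (intro polys_sum polys_mult) (auto simp: graded_mat_def)
  show "homogeneous (fs ! c - ds ! r) ((A * B) $$ (r, c))"
    unfolding e
  proof (intro homogeneous_sum)
    fix i assume "i \<in> {..<length es}"
    then have "homogeneous ((es ! i - ds ! r) + (fs ! c - es ! i)) (A $$ (r, i) * B $$ (i, c))"
      using assms rc by (intro homogeneous_mult) (auto simp: graded_mat_def)
    then show "homogeneous (fs ! c - ds ! r) (A $$ (r, i) * B $$ (i, c))" by simp
  qed
qed

lemma graded_mat_minus:
  "graded_mat V ds es A \<Longrightarrow> graded_mat V ds es B \<Longrightarrow> graded_mat V ds es (A - B)"
  unfolding graded_mat_def by (auto intro!: polys_diff homogeneous_diff)

lemma graded_mat_one: "graded_mat V ds ds (1\<^sub>m (length ds))"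
  by (auto simp: graded_mat_def homogeneous_1)

lemma graded_mat_zero: "graded_mat V ds es (0\<^sub>m (length ds) (length es))"
  by (auto simp: graded_mat_def)

lemma graded_mat_col:
  "graded_mat V ds es A \<Longrightarrow> j < length es \<Longrightarrow> col A j \<in> free_module V (length ds)"
  by (auto simp: graded_mat_def free_module_def)

lemma graded_mat_mult_vec:
  assumes "graded_mat V ds es A" "v \<in> free_module V (length es)"
  shows "A *\<^sub>v v \<in> free_module V (length ds)"
  using free_module_mult_mat_vec[OF graded_mat_carrier[OF assms(1)] _ assms(2)] assms(1)
  by (simp add: graded_mat_def)

text \<open>
  Graded free modules are projective: lift each column and keep the components of the right
  degree.
\<close>

lemma graded_lift:
  assumes D: "graded_mat V ds es D" and B: "graded_mat V ds fs B"
    and img: "\<And>j. j < length fs \<Longrightarrow> \<exists>w\<in>free_module V (length es). col B j = D *\<^sub>v w"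
  shows "\<exists>C. graded_mat V es fs C \<and> D * C = B"
proof -
  from img have "\<forall>j. \<exists>w. j < length fs \<longrightarrow> w \<in> free_module V (length es) \<and> col B j = D *\<^sub>v w" by blast
  from choice[OF this] obtain w where
    w: "\<And>j. j < length fs \<Longrightarrow> w j \<in> free_module V (length es)"
      "\<And>j. j < length fs \<Longrightarrow> col B j = D *\<^sub>v w j" by blast
  define C where "C = mat (length es) (length fs) (\<lambda>(i, j). hcomp (fs ! j - es ! i) (w j $ i))"
  have C: "graded_mat V es fs C"
    using w(1) by (auto simp: graded_mat_def C_def homogeneous_hcomp free_module_def intro: hcomp_polys)
  note Dc = graded_mat_carrier[OF D] and Bc = graded_mat_carrier[OF B] and Cc = graded_mat_carrier[OF C]
  have "D * C = B"
  proof (rule eq_matI)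
    fix r j assume "r < dim_row B" "j < dim_col B"
    then have rj: "r < length ds" "j < length fs" using Bc by simp_all
    let ?e = "fs ! j - ds ! r"
    have "B $$ (r, j) = (D *\<^sub>v w j) $ r" using w(2)[OF rj(2)] Bc rj by (metis carrier_matD index_col)
    also have "\<dots> = (\<Sum>i<length es. w j $ i * D $$ (r, i))"
      using rj Dc w(1)[OF rj(2)]
      by (auto simp: scalar_prod_def atLeast0LessThan free_module_def mult.commute intro!: sum.cong)
    finally have b: "B $$ (r, j) = (\<Sum>i<length es. w j $ i * D $$ (r, i))" .
    have "homogeneous ?e (B $$ (r, j))" using B rj by (simp add: graded_mat_def)
    from hcomp_homogeneous[OF this, of ?e] have "B $$ (r, j) = hcomp ?e (B $$ (r, j))" by simp
    also have "\<dots> = (\<Sum>i<length es. hcomp ?e (w j $ i * D $$ (r, i)))" by (simp add: b hcomp_sum)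
    also have "\<dots> = (\<Sum>i<length es. D $$ (r, i) * C $$ (i, j))"
    proof (rule sum.cong[OF refl])
      fix i assume i: "i \<in> {..<length es}"
      then have "homogeneous (es ! i - ds ! r) (D $$ (r, i))" using D rj by (simp add: graded_mat_def)
      from hcomp_mult[OF this, of ?e "w j $ i"]
      show "hcomp ?e (w j $ i * D $$ (r, i)) = D $$ (r, i) * C $$ (i, j)"
        using i rj by (simp add: C_def mult.commute)
    qed
    also have "\<dots> = (D * C) $$ (r, j)"
      using rj Dc Cc by (simp add: scalar_prod_def atLeast0LessThan)
    finally show "(D * C) $$ (r, j) = B $$ (r, j)" ..
  qed (use Dc Bc Cc in auto)
  with C show ?thesis by blast
qed

text \<open>
  The augmented complex has the polynomial ring itself in position 0, which shifts the
  indices of the resolution by one.  Then the augmentation and the differentials satisfy the same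
  exactness statement.
\<close>

definition aug_degs :: "('v, 'k::field) free_complex \<Rightarrow> nat \<Rightarrow> int list" where
  "aug_degs F i = (case i of 0 \<Rightarrow> [0] | Suc i \<Rightarrow> degs F i)"

definition aug_bd :: "('v, 'k::field) free_complex \<Rightarrow> nat \<Rightarrow> ('v, 'k) mpoly mat" where
  "aug_bd F i = (case i of 0 \<Rightarrow> mat 1 (rk F 0) (\<lambda>(r, c). aug F $ c) | Suc i \<Rightarrow> bd F i)"

lemma aug_simps [simp]:
  "aug_degs F 0 = [0]" "aug_degs F (Suc i) = degs F i" "aug_bd F (Suc i) = bd F i"
  by (simp_all add: aug_degs_def aug_bd_def)

lemma resolution_graded_mat:
  assumes "graded_free_resolution V L F"
  shows "graded_mat V (aug_degs F i) (aug_degs F (Suc i)) (aug_bd F i)"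
proof (cases i)
  case 0
  then show ?thesis using assms
    by (auto simp: graded_mat_def aug_bd_def graded_free_resolution_def free_module_def)
next
  case (Suc i')
  then show ?thesis using assms by (auto simp: graded_mat_def graded_free_resolution_def)
qed

lemma aug_bd_0_mult:
  assumes "graded_free_resolution V L F" "v \<in> carrier_vec (rk F 0)"
  shows "aug_bd F 0 *\<^sub>v v = vec 1 (\<lambda>_. aug F \<bullet> v)"
proof (rule eq_vecI)
  have a: "dim_vec (aug F) = rk F 0" using assms(1) by (simp add: graded_free_resolution_def free_module_def)
  fix i assume "i < dim_vec (vec 1 (\<lambda>_. aug F \<bullet> v))"
  then show "(aug_bd F 0 *\<^sub>v v) $ i = vec 1 (\<lambda>_. aug F \<bullet> v) $ i"
    using a assms(2) by (simp add: aug_bd_def scalar_prod_def)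
qed (simp add: aug_bd_def)

lemma resolution_exact:
  assumes F: "graded_free_resolution V L F" and v: "v \<in> free_module V (length (aug_degs F (Suc i)))"
  shows "aug_bd F i *\<^sub>v v = 0\<^sub>v (length (aug_degs F i)) \<longleftrightarrow>
    (\<exists>w\<in>free_module V (length (aug_degs F (Suc (Suc i)))). v = aug_bd F (Suc i) *\<^sub>v w)"
proof (cases i)
  case 0
  have e: "{v \<in> free_module V (rk F 0). aug F \<bullet> v = 0} =
       {bd F 0 *\<^sub>v w |w. w \<in> free_module V (rk F 1)}" using F by (simp add: graded_free_resolution_def)
  have "aug_bd F 0 *\<^sub>v v = 0\<^sub>v 1 \<longleftrightarrow> aug F \<bullet> v = 0"
    using v 0 by (subst aug_bd_0_mult[OF F]) (auto simp: free_module_def vec_eq_iff)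
  also have "\<dots> \<longleftrightarrow> v \<in> {v \<in> free_module V (rk F 0). aug F \<bullet> v = 0}" using v 0 by simp
  finally show ?thesis unfolding e using 0 by auto
next
  case (Suc i')
  have e: "{v \<in> free_module V (rk F (Suc i')). bd F i' *\<^sub>v v = 0\<^sub>v (rk F i')} =
          {bd F (Suc i') *\<^sub>v w |w. w \<in> free_module V (rk F (Suc (Suc i')))}"
    using F by (simp add: graded_free_resolution_def)
  have "bd F i' *\<^sub>v v = 0\<^sub>v (rk F i') \<longleftrightarrow>
      v \<in> {v \<in> free_module V (rk F (Suc i')). bd F i' *\<^sub>v v = 0\<^sub>v (rk F i')}" using v Suc by simp
  then show ?thesis unfolding e using Suc by auto
qed

lemma resolution_image:
  assumes F: "graded_free_resolution V L F" and v: "v \<in> carrier_vec 1"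
  shows "v $ 0 \<in> L \<longleftrightarrow> (\<exists>w\<in>free_module V (rk F 0). v = aug_bd F 0 *\<^sub>v w)"
proof -
  have L: "L = {aug F \<bullet> v |v. v \<in> free_module V (rk F 0)}"
    using F by (simp add: graded_free_resolution_def)
  have "v = aug_bd F 0 *\<^sub>v w \<longleftrightarrow> v $ 0 = aug F \<bullet> w" if "w \<in> free_module V (rk F 0)" for w
    using v that by (subst aug_bd_0_mult[OF F]) (auto simp: free_module_def vec_eq_iff)
  then show ?thesis unfolding L by auto
qed

lemma mat_eq_0_if_vec:
  fixes A :: "'a::comm_ring_1 mat"
  assumes A: "A \<in> carrier_mat n m" and z: "\<And>j. j < m \<Longrightarrow> A *\<^sub>v unit_vec m j = 0\<^sub>v n"
  shows "A = 0\<^sub>m n m"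
proof (rule eq_matI)
  fix i j assume "i < dim_row (0\<^sub>m n m :: 'a mat)" "j < dim_col (0\<^sub>m n m :: 'a mat)"
  then have ij: "i < n" "j < m" by simp_all
  have "A $$ (i, j) = (A *\<^sub>v unit_vec m j) $ i" using A ij by simp
  then show "A $$ (i, j) = 0\<^sub>m n m $$ (i, j)" using z[OF ij(2)] ij by simp
qed (use A in auto)

lemma unit_vec_free_module: "unit_vec n j \<in> free_module V n"
  by (auto simp: free_module_def unit_vec_def)

lemma resolution_complex:
  assumes F: "graded_free_resolution V L F"
  shows "aug_bd F i * aug_bd F (Suc i) = 0\<^sub>m (length (aug_degs F i)) (length (aug_degs F (Suc (Suc i))))"
proof (rule mat_eq_0_if_vec)
  note g = resolution_graded_mat[OF F, of i] resolution_graded_mat[OF F, of "Suc i"]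
  note c = g[THEN graded_mat_carrier]
  show "aug_bd F i * aug_bd F (Suc i) \<in> carrier_mat (length (aug_degs F i)) (length (aug_degs F (Suc (Suc i))))"
    using c by simp
  fix j
  let ?u = "unit_vec (length (aug_degs F (Suc (Suc i)))) j :: (_, _) mpoly vec"
  have u: "?u \<in> free_module V (length (aug_degs F (Suc (Suc i))))" by (rule unit_vec_free_module)
  have "aug_bd F i *\<^sub>v (aug_bd F (Suc i) *\<^sub>v ?u) = 0\<^sub>v (length (aug_degs F i))"
    using resolution_exact[OF F graded_mat_mult_vec[OF g(2) u]] u by blast
  then show "aug_bd F i * aug_bd F (Suc i) *\<^sub>v ?u = 0\<^sub>v (length (aug_degs F i))"
    using assoc_mult_mat_vec[OF c, of ?u] by simp
qed

lemma resolution_lift: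
  assumes F: "graded_free_resolution V L F"
    and B: "graded_mat V (aug_degs F (Suc n)) fs B"
    and z: "aug_bd F n * B = 0\<^sub>m (length (aug_degs F n)) (length fs)"
  shows "\<exists>C. graded_mat V (aug_degs F (Suc (Suc n))) fs C \<and> aug_bd F (Suc n) * C = B"
proof (rule graded_lift[OF resolution_graded_mat[OF F] B])
  fix j assume j: "j < length fs"
  have "aug_bd F n *\<^sub>v col B j = col (aug_bd F n * B) j"
    by (rule col_mult2[symmetric, OF graded_mat_carrier[OF resolution_graded_mat[OF F]] graded_mat_carrier[OF B] j])
  also have "\<dots> = 0\<^sub>v (length (aug_degs F n))" unfolding z using j by simp
  finally show "\<exists>w\<in>free_module V (length (aug_degs F (Suc (Suc n)))). col B j = aug_bd F (Suc n) *\<^sub>v w"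
    using resolution_exact[OF F graded_mat_col[OF B j]] by simp
qed

text \<open>
  The identity of the polynomial ring lifts step by step: each composite with a differential
  of \<open>F\<close> consists of cycles of \<open>G\<close>, which are boundaries.
\<close>

theorem comparison_map:
  assumes F: "graded_free_resolution V L F" and G: "graded_free_resolution V L G"
  shows "\<exists>f. f 0 = 1\<^sub>m 1 \<and> (\<forall>i. graded_mat V (aug_degs G i) (aug_degs F i) (f i)) \<and>
    (\<forall>i. aug_bd G i * f (Suc i) = f i * aug_bd F i)"
proof -
  note gF = resolution_graded_mat[OF F] and gG = resolution_graded_mat[OF G]
  note cF = gF[THEN graded_mat_carrier] and cG = gG[THEN graded_mat_carrier]
  define P where "P n A \<longleftrightarrow> graded_mat V (aug_degs G n) (aug_degs F n) A \<and>
    (\<exists>C. graded_mat V (aug_degs G (Suc n)) (aug_degs F (Suc n)) C \<and> aug_bd G n * C = A * aug_bd F n) \<and>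
    (n = 0 \<longrightarrow> A = 1\<^sub>m 1)" for n A
  define Q where "Q n A C \<longleftrightarrow> aug_bd G n * C = A * aug_bd F n" for n A C
  have "\<exists>f. \<forall>i. P i (f i) \<and> Q i (f i) (f (Suc i))"
  proof (rule dependent_nat_choice)
    have 1: "graded_mat V (aug_degs G 0) (aug_degs F 0) (1\<^sub>m 1)"
      using graded_mat_one[of V "[0]"] by simp
    have "\<exists>C. graded_mat V (aug_degs G (Suc 0)) (aug_degs F (Suc 0)) C \<and> aug_bd G 0 * C = aug_bd F 0"
    proof (rule graded_lift[OF gG])
      show F0: "graded_mat V (aug_degs G 0) (aug_degs F (Suc 0)) (aug_bd F 0)"
        using gF[of 0] by simp
      fix j assume j: "j < length (aug_degs F (Suc 0))"
      let ?u = "unit_vec (rk F 0) j :: (_, _) mpoly vec"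
      have c: "col (aug_bd F 0) j \<in> carrier_vec 1" using cF[of 0] j by simp
      have "col (aug_bd F 0) j = aug_bd F 0 *\<^sub>v ?u"
      proof (rule eq_vecI)
        fix i assume "i < dim_vec (aug_bd F 0 *\<^sub>v ?u)"
        then show "col (aug_bd F 0) j $ i = (aug_bd F 0 *\<^sub>v ?u) $ i"
          using j cF[of 0] by (simp add: aug_bd_def)
      qed (simp add: aug_bd_def)
      then have "col (aug_bd F 0) j $ 0 \<in> L"
        using resolution_image[OF F c] unit_vec_free_module by blast
      then show "\<exists>w\<in>free_module V (length (aug_degs G (Suc 0))). col (aug_bd F 0) j = aug_bd G 0 *\<^sub>v w"
        using resolution_image[OF G c] by simp
    qed
    then show "\<exists>A. P 0 A" unfolding P_def using 1 cF[of 0]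
      by (intro exI[of _ "1\<^sub>m 1"]) simp
  next
    fix A n assume "P n A"
    then obtain C where A: "graded_mat V (aug_degs G n) (aug_degs F n) A"
      and C: "graded_mat V (aug_degs G (Suc n)) (aug_degs F (Suc n)) C" "aug_bd G n * C = A * aug_bd F n"
      unfolding P_def by blast
    have "\<exists>C'. graded_mat V (aug_degs G (Suc (Suc n))) (aug_degs F (Suc (Suc n))) C' \<and>
        aug_bd G (Suc n) * C' = C * aug_bd F (Suc n)"
    proof (rule resolution_lift[OF G])
      show "graded_mat V (aug_degs G (Suc n)) (aug_degs F (Suc (Suc n))) (C * aug_bd F (Suc n))"
        by (rule graded_mat_mult[OF C(1) gF])
      have "aug_bd G n * (C * aug_bd F (Suc n)) = (aug_bd G n * C) * aug_bd F (Suc n)"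
        by (rule assoc_mult_mat[symmetric, OF cG graded_mat_carrier[OF C(1)] cF])
      also have "\<dots> = A * (aug_bd F n * aug_bd F (Suc n))"
        unfolding C(2) by (rule assoc_mult_mat[OF graded_mat_carrier[OF A] cF cF])
      also have "\<dots> = 0\<^sub>m (length (aug_degs G n)) (length (aug_degs F (Suc (Suc n))))"
        unfolding resolution_complex[OF F] by (rule right_mult_zero_mat[OF graded_mat_carrier[OF A]])
      finally show "aug_bd G n * (C * aug_bd F (Suc n)) =
        0\<^sub>m (length (aug_degs G n)) (length (aug_degs F (Suc (Suc n))))" .
    qed
    with C show "\<exists>C. P (Suc n) C \<and> Q n A C" unfolding P_def Q_def by blast
  qed
  then obtain f where "\<And>i. P i (f i)" "\<And>i. Q i (f i) (f (Suc i))" by blast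
  then show ?thesis unfolding P_def Q_def by (intro exI[of _ f]) simp
qed

text \<open>
  A lift of the zero map is null-homotopic; the homotopy starts with zero and is again
  lifted step by step.
\<close>

theorem chain_map_null_homotopic:
  assumes F: "graded_free_resolution V L F"
    and \<phi>: "\<And>i. graded_mat V (aug_degs F i) (aug_degs F i) (\<phi> i)"
    and comm: "\<And>i. aug_bd F i * \<phi> (Suc i) = \<phi> i * aug_bd F i" and \<phi>0: "\<phi> 0 = 0\<^sub>m 1 1"
  shows "\<exists>h. h 0 = 0\<^sub>m (rk F 0) 1 \<and> (\<forall>i. graded_mat V (aug_degs F (Suc i)) (aug_degs F i) (h i)) \<and>
    (\<forall>i. \<phi> (Suc i) = aug_bd F (Suc i) * h (Suc i) + h i * aug_bd F i)"
proof -
  note gF = resolution_graded_mat[OF F]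
  note cF = gF[THEN graded_mat_carrier] and c\<phi> = \<phi>[THEN graded_mat_carrier]
  define P where "P n h \<longleftrightarrow> graded_mat V (aug_degs F (Suc n)) (aug_degs F n) h \<and>
    aug_bd F n * (\<phi> (Suc n) - h * aug_bd F n) = 0\<^sub>m (length (aug_degs F n)) (length (aug_degs F (Suc n))) \<and>
    (n = 0 \<longrightarrow> h = 0\<^sub>m (rk F 0) 1)" for n h
  define Q where "Q n h h' \<longleftrightarrow> \<phi> (Suc n) = aug_bd F (Suc n) * h' + h * aug_bd F n" for n h h'
  have "\<exists>h. \<forall>i. P i (h i) \<and> Q i (h i) (h (Suc i))"
  proof (rule dependent_nat_choice)
    have h: "graded_mat V (aug_degs F (Suc 0)) (aug_degs F 0) (0\<^sub>m (rk F 0) 1)"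
      using graded_mat_zero[of V "degs F 0" "[0]"] by simp
    have "0\<^sub>m (rk F 0) 1 * aug_bd F 0 = 0\<^sub>m (rk F 0) (rk F 0)"
      using cF[of 0] by simp
    moreover have "\<phi> (Suc 0) - 0\<^sub>m (rk F 0) (rk F 0) = \<phi> (Suc 0)"
      using c\<phi>[of "Suc 0"] by (intro eq_matI) auto
    moreover have "aug_bd F 0 * \<phi> (Suc 0) = 0\<^sub>m 1 (rk F 0)"
      using cF[of 0] by (simp add: comm \<phi>0)
    ultimately have "aug_bd F 0 * (\<phi> (Suc 0) - 0\<^sub>m (rk F 0) 1 * aug_bd F 0) = 0\<^sub>m 1 (rk F 0)" by simp
    then show "\<exists>h. P 0 h" using h unfolding P_def by (intro exI[of _ "0\<^sub>m (rk F 0) 1"]) simp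
  next
    fix h n assume "P n h"
    then have h: "graded_mat V (aug_degs F (Suc n)) (aug_degs F n) h"
      and z: "aug_bd F n * (\<phi> (Suc n) - h * aug_bd F n) =
        0\<^sub>m (length (aug_degs F n)) (length (aug_degs F (Suc n)))" unfolding P_def by blast+
    note ch = graded_mat_carrier[OF h]
    have g: "graded_mat V (aug_degs F (Suc n)) (aug_degs F (Suc n)) (\<phi> (Suc n) - h * aug_bd F n)"
      by (rule graded_mat_minus[OF \<phi> graded_mat_mult[OF h gF]])
    from resolution_lift[OF F g z] obtain h' where
      h': "graded_mat V (aug_degs F (Suc (Suc n))) (aug_degs F (Suc n)) h'"
      and e: "aug_bd F (Suc n) * h' = \<phi> (Suc n) - h * aug_bd F n" by blast
    note ch' = graded_mat_carrier[OF h']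
    let ?D = "aug_bd F n" and ?D' = "aug_bd F (Suc n)"
    have Q: "Q n h h'"
      unfolding Q_def e using c\<phi>[of "Suc n"] ch cF[of n] by (intro eq_matI) auto
    have "?D' * (\<phi> (Suc (Suc n)) - h' * ?D') = ?D' * \<phi> (Suc (Suc n)) - ?D' * (h' * ?D')"
      using mult_minus_distrib_mat[OF cF c\<phi> mult_carrier_mat[OF ch' cF]] .
    also have "?D' * (h' * ?D') = (\<phi> (Suc n) - h * ?D) * ?D'"
      unfolding e[symmetric] by (rule assoc_mult_mat[symmetric, OF cF ch' cF])
    also have "\<dots> = \<phi> (Suc n) * ?D' - h * ?D * ?D'"
      using minus_mult_distrib_mat[OF c\<phi> mult_carrier_mat[OF ch cF] cF] .
    also have "h * ?D * ?D' = h * (?D * ?D')" by (rule assoc_mult_mat[OF ch cF cF])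
    also have "\<dots> = 0\<^sub>m (length (aug_degs F (Suc n))) (length (aug_degs F (Suc (Suc n))))"
      unfolding resolution_complex[OF F] by (rule right_mult_zero_mat[OF ch])
    also have "?D' * \<phi> (Suc (Suc n)) = \<phi> (Suc n) * ?D'" by (rule comm)
    also have "\<phi> (Suc n) * ?D' - (\<phi> (Suc n) * ?D' - 0\<^sub>m (length (aug_degs F (Suc n))) (length (aug_degs F (Suc (Suc n)))))
        = 0\<^sub>m (length (aug_degs F (Suc n))) (length (aug_degs F (Suc (Suc n))))"
      using mult_carrier_mat[OF c\<phi>[of "Suc n"] cF[of "Suc n"]] by (intro eq_matI) auto
    finally have "P (Suc n) h'" unfolding P_def using h' by simp
    with Q show "\<exists>h'. P (Suc n) h' \<and> Q n h h'" by blast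
  qed
  then obtain h where "\<And>i. P i (h i)" "\<And>i. Q i (h i) (h (Suc i))" by blast
  then show ?thesis unfolding P_def Q_def by (intro exI[of _ h]) simp
qed


section \<open>Dimensions of subspaces\<close>

text \<open>
  A maximal independent subset of \<open>W\<close> is a basis of \<open>W\<close>; one exists because the dimension of the
  whole space bounds the size of independent sets.
\<close>

lemma (in vectorspace) subspace_has_independent_spanning_set:
  assumes fd: fin_dim and W: "VectorSpace.subspace K W V"
  shows "\<exists>A. finite A \<and> A \<subseteq> W \<and> lin_indpt A \<and> W \<subseteq> span A \<and>
    vectorspace.fin_dim K (vs W) \<and> vectorspace.dim K (vs W) = card A"
proof -
  interpret W: vectorspace K "vs W" by (rule subspace_is_vs[OF W])
  have sub: "submodule K W V" using W by (simp add: VectorSpace.subspace_def)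
  then have WV: "W \<subseteq> carrier V" by (simp add: submodule_def)
  have li: "W.lin_indpt A \<longleftrightarrow> lin_indpt A" if "A \<subseteq> W" for A
    using span_li_not_depend(2)[OF that sub] by simp
  have "\<exists>A. finite A \<and> maximal A (\<lambda>S. S \<subseteq> W \<and> lin_indpt S)"
  proof (rule maximal_exists)
    show "finite A \<and> card A \<le> dim" if "A \<subseteq> W \<and> lin_indpt A" for A
      using li_le_dim[OF fd, of A] that WV by blast
    show "{} \<subseteq> W \<and> lin_indpt {}" by (auto simp: lin_dep_def)
  qed
  then obtain A where A: "finite A" "maximal A (\<lambda>S. S \<subseteq> W \<and> lin_indpt S)" by blast
  have AW: "A \<subseteq> W" "lin_indpt A" using A(2) by (simp_all add: maximal_def)
  have "maximal A (\<lambda>S. S \<subseteq> carrier (vs W) \<and> W.lin_indpt S)"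
    using A(2) li unfolding maximal_def by auto
  then have basis: "W.basis A" by (rule W.max_li_is_basis)
  then have "W.span A = W" by (simp add: W.basis_def)
  then have "W \<subseteq> span A" using span_li_not_depend(1)[OF AW(1) sub] by simp
  moreover have "W.fin_dim" using basis A(1) unfolding W.fin_dim_def W.basis_def by blast
  ultimately show ?thesis using A(1) AW W.dim_basis[OF A(1) basis] by blast
qed

lemma (in vectorspace) dim_strict_mono:
  assumes fd: fin_dim and W1: "VectorSpace.subspace K W1 V" and W2: "VectorSpace.subspace K W2 V"
    and less: "W1 \<subset> W2"
  shows "vectorspace.dim K (vs W1) < vectorspace.dim K (vs W2)"
proof -
  obtain A where A: "finite A" "A \<subseteq> W1" "lin_indpt A" "vectorspace.dim K (vs W1) = card A"
    using subspace_has_independent_spanning_set[OF fd W1] by blast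
  have fd2: "vectorspace.fin_dim K (vs W2)"
    using subspace_has_independent_spanning_set[OF fd W2] by blast
  interpret W2: vectorspace K "vs W2" by (rule subspace_is_vs[OF W2])
  have sub1: "submodule K W1 V" and sub2: "submodule K W2 V"
    using W1 W2 by (simp_all add: VectorSpace.subspace_def)
  then have WV: "W1 \<subseteq> carrier V" "W2 \<subseteq> carrier V" by (simp_all add: submodule_def)
  obtain v where v: "v \<in> W2" "v \<notin> W1" using less by blast
  have "span A \<subseteq> W1" by (rule span_is_subset[OF A(2) sub1])
  then have "v \<notin> span A" using v(2) by blast
  moreover have "v \<notin> A" using A(2) v(2) by blast
  ultimately have "lin_indpt (A \<union> {v})"
    using lin_dep_iff_in_span[of A v] A(2,3) v(1) WV by blast
  then have "W2.lin_indpt (A \<union> {v})"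
    using span_li_not_depend(2)[OF _ sub2, of "A \<union> {v}"] A(2) v(1) less by simp
  then have "card (A \<union> {v}) \<le> W2.dim"
    using W2.li_le_dim(2)[OF fd2, of "A \<union> {v}"] A(2) v(1) less by auto
  then show ?thesis using A(1,4) \<open>v \<notin> A\<close> by simp
qed

lemma subspace_dim_strict_mono:
  fixes W1 W2 :: "'k::field vec set"
  assumes W1: "W1 \<subseteq> W2" "W1 \<noteq> W2" and W2: "W2 \<subseteq> carrier_vec n"
    and cl1: "0\<^sub>v n \<in> W1" "\<And>v w. v \<in> W1 \<Longrightarrow> w \<in> W1 \<Longrightarrow> v + w \<in> W1" "\<And>a v. v \<in> W1 \<Longrightarrow> a \<cdot>\<^sub>v v \<in> W1"
    and cl2: "0\<^sub>v n \<in> W2" "\<And>v w. v \<in> W2 \<Longrightarrow> w \<in> W2 \<Longrightarrow> v + w \<in> W2" "\<And>a v. v \<in> W2 \<Longrightarrow> a \<cdot>\<^sub>v v \<in> W2"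
  shows "subspace_dim n W1 < subspace_dim n W2"
proof -
  interpret vec_space "TYPE('k)" n .
  have "VectorSpace.subspace class_ring W V"
    if "W \<subseteq> carrier_vec n" "0\<^sub>v n \<in> W" "\<And>v w. v \<in> W \<Longrightarrow> w \<in> W \<Longrightarrow> v + w \<in> W"
      "\<And>a v. v \<in> W \<Longrightarrow> a \<cdot>\<^sub>v v \<in> W" for W :: "'k vec set"
    unfolding VectorSpace.subspace_def submodule_def
    using that by (auto simp: module_vec_simps class_field vec_vs vec_module)
  note sub = this
  show ?thesis unfolding subspace_dim_def
  proof (rule dim_strict_mono[OF fin_dim])
    show "VectorSpace.subspace class_ring W1 V" using W1 W2 cl1 by (intro sub) auto
    show "VectorSpace.subspace class_ring W2 V" using W2 cl2 by (intro sub) auto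
    show "W1 \<subset> W2" using W1 by blast
  qed
qed


section \<open>Tor from an arbitrary resolution\<close>

interpretation const_term: comm_ring_hom "\<lambda>p :: ('v, 'k::field) mpoly. Poly_Mapping.lookup p 0"
  by unfold_locales (simp_all add: lookup_add const_term_mult)

abbreviation mat_k :: "('v, 'k::field) mpoly mat \<Rightarrow> 'k mat" where
  "mat_k A \<equiv> map_mat (\<lambda>p. Poly_Mapping.lookup p 0) A"

lemma mat_k_zero: "mat_k (0\<^sub>m n m) = 0\<^sub>m n m"
  by (rule eq_matI) auto

lemma mat_k_add:
  "A \<in> carrier_mat n m \<Longrightarrow> B \<in> carrier_mat n m \<Longrightarrow> mat_k (A + B) = mat_k A + mat_k B"
  by (rule eq_matI) (auto simp: lookup_add)

lemma zero_mat_mult_vec: "v \<in> carrier_vec m \<Longrightarrow> 0\<^sub>m n m *\<^sub>v v = (0\<^sub>v n :: 'a::semiring_0 vec)"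
  by (rule eq_vecI) auto

text \<open>
  A vector over \<open>k\<close> that lies in the degree \<open>j\<close> part of a free module tensored with \<open>k\<close>.
\<close>

definition supported :: "int list \<Rightarrow> int \<Rightarrow> 'k::zero vec \<Rightarrow> bool" where
  "supported ds j v \<longleftrightarrow> v \<in> carrier_vec (length ds) \<and> (\<forall>c < length ds. ds ! c \<noteq> j \<longrightarrow> v $ c = 0)"

lemma chains_k_supported: "v \<in> chains_k F i j \<longleftrightarrow> supported (degs F i) j v"
  by (simp add: chains_k_def supported_def)

text \<open>
  An entry with nonzero constant term has degree zero, so it joins generators of equal
  degree.
\<close>

lemma mat_k_mult_supported:
  fixes A :: "('v, 'k::field) mpoly mat"
  assumes A: "graded_mat V ds es A" and v: "supported es j v"
  shows "supported ds j (mat_k A *\<^sub>v v)"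
proof -
  note Ac = graded_mat_carrier[OF A]
  have "(mat_k A *\<^sub>v v) $ r = 0" if r: "r < length ds" "ds ! r \<noteq> j" for r
  proof -
    have "Poly_Mapping.lookup (A $$ (r, c)) 0 * v $ c = 0" if c: "c < length es" for c
    proof (cases "es ! c = j")
      case True
      then have "homogeneous (j - ds ! r) (A $$ (r, c))" using A r(1) c by (auto simp: graded_mat_def)
      then show ?thesis using r(2) by (simp add: homogeneous_const_term)
    next
      case False
      then show ?thesis using v c by (simp add: supported_def)
    qed
    then have "(\<Sum>c<length es. Poly_Mapping.lookup (A $$ (r, c)) 0 * v $ c) = 0"
      by (intro sum.neutral) simp
    moreover have "(mat_k A *\<^sub>v v) $ r = (\<Sum>c<length es. Poly_Mapping.lookup (A $$ (r, c)) 0 * v $ c)"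
      using Ac r(1) v by (auto simp: scalar_prod_def supported_def atLeast0LessThan intro!: sum.cong)
    ultimately show ?thesis by simp
  qed
  then show ?thesis using Ac v unfolding supported_def by auto
qed

lemma boundaries_k_subset_cycles_k:
  assumes F: "graded_free_resolution V L F"
  shows "boundaries_k F i j \<subseteq> cycles_k F i j"
proof
  fix v assume "v \<in> boundaries_k F i j"
  then obtain w where w: "supported (degs F (Suc i)) j w" and v: "v = mat_k (bd F i) *\<^sub>v w"
    unfolding boundaries_k_def chains_k_supported[symmetric] by (auto simp: bd_k_def)
  note g = resolution_graded_mat[OF F, of "Suc i", simplified]
  have chain: "v \<in> chains_k F i j"
    unfolding v chains_k_supported by (rule mat_k_mult_supported[OF g w])
  show "v \<in> cycles_k F i j"
  proof (cases i)
    case 0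
    then show ?thesis using chain by (simp add: cycles_k_def)
  next
    case (Suc i')
    have c: "bd F i' \<in> carrier_mat (rk F i') (rk F i)" "bd F i \<in> carrier_mat (rk F i) (rk F (Suc i))"
      using graded_mat_carrier[OF resolution_graded_mat[OF F, of "Suc i'"]] graded_mat_carrier[OF g] Suc
      by simp_all
    have wc: "w \<in> carrier_vec (rk F (Suc i))" using w by (simp add: supported_def)
    have dd: "bd F i' * bd F i = 0\<^sub>m (rk F i') (rk F (Suc i))"
      using resolution_complex[OF F, of "Suc i'"] by (simp add: Suc)
    have "mat_k (bd F i') * mat_k (bd F i) = mat_k (bd F i' * bd F i)"
      by (rule const_term.mat_hom_mult[OF c, symmetric])
    also have "\<dots> = 0\<^sub>m (rk F i') (rk F (Suc i))" unfolding dd by (rule mat_k_zero)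
    finally have "mat_k (bd F i') * mat_k (bd F i) = 0\<^sub>m (rk F i') (rk F (Suc i))" .
    then have "mat_k (bd F i') *\<^sub>v v = 0\<^sub>v (rk F i')"
      unfolding v using c wc assoc_mult_mat_vec[of "mat_k (bd F i')" _ _ "mat_k (bd F i)" _ w]
      by (metis map_carrier_mat zero_mat_mult_vec)
    then show ?thesis using chain Suc by (simp add: cycles_k_def bd_k_def)
  qed
qed

text \<open>
  Write the identity of \<open>F\<close> as \<open>g f + d h + h d\<close> with comparison maps \<open>f\<close>, \<open>g\<close> and a
  homotopy \<open>h\<close>, and apply the constant terms of these matrices to a cycle \<open>z\<close> of degree \<open>j\<close>.  The
  vector \<open>f z\<close> vanishes for lack of generators of degree \<open>j\<close>, and \<open>d z = 0\<close>.  There remains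
  \<open>z = d h z\<close>.
\<close>

theorem cycles_k_subset_boundaries_k:
  fixes F G :: "('v, 'k::field) free_complex"
  assumes F: "graded_free_resolution V L F" and G: "graded_free_resolution V L G"
    and G_degs: "\<And>c. c < rk G i \<Longrightarrow> degs G i ! c \<noteq> j"
  shows "cycles_k F i j \<subseteq> boundaries_k F i j"
proof
  fix z assume z: "z \<in> cycles_k F i j"
  then have chain: "supported (degs F i) j z"
    by (auto simp: cycles_k_def chains_k_supported[symmetric] split: nat.splits)
  note gF = resolution_graded_mat[OF F] and gG = resolution_graded_mat[OF G]
  note cF = gF[THEN graded_mat_carrier] and cG = gG[THEN graded_mat_carrier]
  obtain f where f0: "f 0 = 1\<^sub>m 1" and f: "\<And>i. graded_mat V (aug_degs G i) (aug_degs F i) (f i)"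
    and f_comm: "\<And>i. aug_bd G i * f (Suc i) = f i * aug_bd F i"
    using comparison_map[OF F G] by blast
  obtain g where g0: "g 0 = 1\<^sub>m 1" and g: "\<And>i. graded_mat V (aug_degs F i) (aug_degs G i) (g i)"
    and g_comm: "\<And>i. aug_bd F i * g (Suc i) = g i * aug_bd G i"
    using comparison_map[OF G F] by blast
  note cf = f[THEN graded_mat_carrier] and cg = g[THEN graded_mat_carrier]
  define \<phi> where "\<phi> i = 1\<^sub>m (length (aug_degs F i)) - g i * f i" for i
  have gf: "graded_mat V (aug_degs F i) (aug_degs F i) (g i * f i)" for i
    by (rule graded_mat_mult[OF g f])
  note cgf = gf[THEN graded_mat_carrier]
  have \<phi>: "graded_mat V (aug_degs F i) (aug_degs F i) (\<phi> i)" for i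
    unfolding \<phi>_def by (rule graded_mat_minus[OF graded_mat_one gf])
  have comm: "aug_bd F i * \<phi> (Suc i) = \<phi> i * aug_bd F i" for i
  proof -
    have "aug_bd F i * (g (Suc i) * f (Suc i)) = (aug_bd F i * g (Suc i)) * f (Suc i)"
      by (rule assoc_mult_mat[symmetric, OF cF cg cf])
    also have "\<dots> = g i * (aug_bd G i * f (Suc i))"
      unfolding g_comm by (rule assoc_mult_mat[OF cg cG cf])
    also have "\<dots> = g i * f i * aug_bd F i"
      unfolding f_comm by (rule assoc_mult_mat[symmetric, OF cg cf cF])
    finally have e: "aug_bd F i * (g (Suc i) * f (Suc i)) = g i * f i * aug_bd F i" .
    have "aug_bd F i * \<phi> (Suc i) = aug_bd F i * 1\<^sub>m (length (aug_degs F (Suc i))) - aug_bd F i * (g (Suc i) * f (Suc i))"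
      unfolding \<phi>_def by (rule mult_minus_distrib_mat[OF cF one_carrier_mat cgf])
    also have "\<dots> = 1\<^sub>m (length (aug_degs F i)) * aug_bd F i - g i * f i * aug_bd F i"
      unfolding e using cF[of i] by (simp only: right_mult_one_mat[OF cF] left_mult_one_mat[OF cF])
    also have "\<dots> = \<phi> i * aug_bd F i"
      unfolding \<phi>_def by (rule minus_mult_distrib_mat[symmetric, OF one_carrier_mat cgf cF])
    finally show ?thesis .
  qed
  have "\<phi> 0 = 0\<^sub>m 1 1" by (simp add: \<phi>_def f0 g0)
  from chain_map_null_homotopic[OF F \<phi> comm this] obtain h where h0: "h 0 = 0\<^sub>m (rk F 0) 1"
    and h: "\<And>i. graded_mat V (aug_degs F (Suc i)) (aug_degs F i) (h i)"
    and homotopy: "\<And>i. \<phi> (Suc i) = aug_bd F (Suc i) * h (Suc i) + h i * aug_bd F i" by blast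
  note ch = h[THEN graded_mat_carrier]
  have zc: "z \<in> carrier_vec (rk F i)" using chain by (simp add: supported_def)
  have kc: "mat_k A \<in> carrier_mat r c" if "A \<in> carrier_mat r c" for A :: "('v, 'k) mpoly mat" and r c
    using that by simp

  have fz: "mat_k (f (Suc i)) *\<^sub>v z = 0\<^sub>v (rk G i)"
  proof -
    have "supported (degs G i) j (mat_k (f (Suc i)) *\<^sub>v z)"
      using mat_k_mult_supported[OF f[of "Suc i"]] chain by simp
    then show ?thesis using G_degs cf[of "Suc i"] by (intro eq_vecI) (auto simp: supported_def)
  qed
  have Dz: "mat_k (h i * aug_bd F i) *\<^sub>v z = 0\<^sub>v (rk F i)"
  proof (cases i)
    case 0
    then have "h i * aug_bd F i = 0\<^sub>m (rk F 0) (rk F 0)"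
      using cF[of 0] by (simp add: h0)
    then show ?thesis using zc 0 by (simp add: mat_k_zero zero_mat_mult_vec)
  next
    case (Suc i')
    have "mat_k (aug_bd F i) *\<^sub>v z = 0\<^sub>v (rk F i')"
      using z Suc by (simp add: cycles_k_def bd_k_def)
    moreover have "mat_k (h i * aug_bd F i) *\<^sub>v z = mat_k (h i) *\<^sub>v (mat_k (aug_bd F i) *\<^sub>v z)"
      unfolding const_term.mat_hom_mult[OF ch cF]
      by (rule assoc_mult_mat_vec[OF kc[OF ch] kc[OF cF]]) (simp add: zc)
    moreover have "mat_k (h i) *\<^sub>v 0\<^sub>v (rk F i') = 0\<^sub>v (rk F i)"
      using kc[OF ch[of i]] Suc by (intro eq_vecI) auto
    ultimately show ?thesis by simp
  qed
  have "1\<^sub>m (rk F i) = \<phi> (Suc i) + g (Suc i) * f (Suc i)"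
    unfolding \<phi>_def using cgf[of "Suc i"] by (intro eq_matI) auto
  then have "1\<^sub>m (rk F i) =
      (bd F i * h (Suc i) + h i * aug_bd F i) + g (Suc i) * f (Suc i)" by (simp add: homotopy)
  then have "mat_k (1\<^sub>m (rk F i) :: ('v, 'k) mpoly mat) =
      mat_k ((bd F i * h (Suc i) + h i * aug_bd F i) + g (Suc i) * f (Suc i))" by (rule arg_cong)
  also have "\<dots> = (mat_k (bd F i * h (Suc i)) + mat_k (h i * aug_bd F i)) + mat_k (g (Suc i) * f (Suc i))"
    using mat_k_add[OF mult_carrier_mat[OF cF[of "Suc i"] ch[of "Suc i"], simplified]
        mult_carrier_mat[OF ch[of i] cF[of i], simplified]]
      mat_k_add[OF add_carrier_mat[OF mult_carrier_mat[OF ch[of i] cF[of i], simplified]]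
        cgf[of "Suc i", simplified], of "bd F i * h (Suc i)"] by simp
  finally have "mat_k (1\<^sub>m (rk F i) :: ('v, 'k) mpoly mat) *\<^sub>v z =
     ((mat_k (bd F i * h (Suc i)) + mat_k (h i * aug_bd F i)) + mat_k (g (Suc i) * f (Suc i))) *\<^sub>v z" by simp
  also have "\<dots> = (mat_k (bd F i * h (Suc i)) + mat_k (h i * aug_bd F i)) *\<^sub>v z + mat_k (g (Suc i) * f (Suc i)) *\<^sub>v z"
    by (rule add_mult_distrib_mat_vec[where nr = "rk F i" and nc = "rk F i"])
      (use cgf[of "Suc i"] mult_carrier_mat[OF cF[of "Suc i"] ch[of "Suc i"]]
        mult_carrier_mat[OF ch[of i] cF[of i]] zc in auto)
  also have "(mat_k (bd F i * h (Suc i)) + mat_k (h i * aug_bd F i)) *\<^sub>v z =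
      mat_k (bd F i * h (Suc i)) *\<^sub>v z + mat_k (h i * aug_bd F i) *\<^sub>v z"
    by (rule add_mult_distrib_mat_vec[where nr = "rk F i" and nc = "rk F i"])
      (use mult_carrier_mat[OF cF[of "Suc i"] ch[of "Suc i"]]
        mult_carrier_mat[OF ch[of i] cF[of i]] zc in auto)
  also have "mat_k (g (Suc i) * f (Suc i)) *\<^sub>v z = mat_k (g (Suc i)) *\<^sub>v (mat_k (f (Suc i)) *\<^sub>v z)"
    unfolding const_term.mat_hom_mult[OF cg cf]
    by (rule assoc_mult_mat_vec[OF kc[OF cg] kc[OF cf]]) (simp add: zc)
  also have "\<dots> = 0\<^sub>v (rk F i)"
    unfolding fz using kc[OF cg[of "Suc i"]] by (intro eq_vecI) auto
  also have "mat_k (bd F i * h (Suc i)) *\<^sub>v z = mat_k (bd F i) *\<^sub>v (mat_k (h (Suc i)) *\<^sub>v z)"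
  proof -
    have c1: "bd F i \<in> carrier_mat (rk F i) (rk F (Suc i))" using cF[of "Suc i"] by simp
    have c2: "h (Suc i) \<in> carrier_mat (rk F (Suc i)) (rk F i)" using ch[of "Suc i"] by simp
    show ?thesis
      unfolding const_term.mat_hom_mult[OF c1 c2] by (rule assoc_mult_mat_vec[OF kc[OF c1] kc[OF c2] zc])
  qed
  finally have "mat_k (1\<^sub>m (rk F i) :: ('v, 'k) mpoly mat) *\<^sub>v z =
      mat_k (bd F i) *\<^sub>v (mat_k (h (Suc i)) *\<^sub>v z) + 0\<^sub>v (rk F i) + 0\<^sub>v (rk F i)"
    unfolding Dz .
  moreover have "mat_k (bd F i) *\<^sub>v (mat_k (h (Suc i)) *\<^sub>v z) \<in> carrier_vec (rk F i)"
    using cF[of "Suc i"] by (auto intro: carrier_vecI)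
  ultimately have "z = bd_k F i *\<^sub>v (mat_k (h (Suc i)) *\<^sub>v z)"
    using zc by (simp add: const_term.mat_hom_one bd_k_def)
  moreover have "mat_k (h (Suc i)) *\<^sub>v z \<in> chains_k F (Suc i) j"
    unfolding chains_k_supported using mat_k_mult_supported[OF h[of "Suc i"]] chain by simp
  ultimately show "z \<in> boundaries_k F i j" unfolding boundaries_k_def by blast
qed

corollary tor_dim_eq_0:
  assumes "graded_free_resolution V L F" "graded_free_resolution V L G"
    and "\<And>c. c < rk G i \<Longrightarrow> degs G i ! c \<noteq> j"
  shows "tor_dim F i j = 0"
proof -
  have "cycles_k F i j = boundaries_k F i j"
    using cycles_k_subset_boundaries_k[OF assms] boundaries_k_subset_cycles_k[OF assms(1)] by blast
  then show ?thesis by (simp add: tor_dim_def)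
qed

text \<open>
  Generators of \<open>F\<^sub>0\<close> of degree below \<open>d\<close> map to zero, so a form \<open>u\<close> of degree \<open>d\<close> in \<open>L\<close> is a
  combination with constant coefficients \<open>z\<close> of the images of the generators of degree \<open>d\<close>.  If
  \<open>z\<close> were a boundary over \<open>k\<close>, then lifting to constants would exhibit \<open>u\<close> as the image of a
  boundary, hence as zero.
\<close>

theorem tor_dim_initial_degree:
  fixes F :: "('v, 'k::field) free_complex"
  assumes F: "graded_free_resolution V L F"
    and low: "\<And>p m. p \<in> L \<Longrightarrow> m \<in> Poly_Mapping.keys p \<Longrightarrow> d \<le> int (mon_degree m)"
    and u: "u \<in> L" "homogeneous d u" "u \<noteq> 0"
  shows "tor_dim F 0 d \<noteq> 0"
proof -
  let ?r = "rk F 0"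
  have L: "L = {aug F \<bullet> v |v. v \<in> free_module V ?r}" and aug: "aug F \<in> free_module V ?r"
    and aug_hom: "\<And>c. c < ?r \<Longrightarrow> homogeneous (degs F 0 ! c) (aug F $ c)"
    and ker: "{v \<in> free_module V ?r. aug F \<bullet> v = 0} = {bd F 0 *\<^sub>v w |w. w \<in> free_module V (rk F 1)}"
    using F by (simp_all add: graded_free_resolution_def)
  have g: "graded_mat V (degs F 0) (degs F 1) (bd F 0)"
    using resolution_graded_mat[OF F, of 1] by simp
  note c = graded_mat_carrier[OF g]
  have aug_low: "aug F $ c = 0" if c: "c < ?r" "degs F 0 ! c < d" for c
  proof -
    have "aug F \<bullet> unit_vec ?r c = aug F $ c" using c(1) by simp
    then have "aug F $ c \<in> L" using L unit_vec_free_module[of ?r c V] by (metis (mono_tags, lifting) mem_Collect_eq)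
    then have "Poly_Mapping.keys (aug F $ c) = {}"
      using low[of "aug F $ c"] aug_hom[OF c(1)] c(2) by (force simp: homogeneous_def)
    then show ?thesis by (intro poly_mapping_eqI) (simp add: in_keys_iff flip: not_in_keys_iff_lookup_eq_zero)
  qed
  obtain v where v: "v \<in> free_module V ?r" "u = aug F \<bullet> v" using u(1) unfolding L by blast
  define z where "z = vec ?r (\<lambda>c. if degs F 0 ! c = d then Poly_Mapping.lookup (v $ c) 0 else 0)"
  have z_chain: "z \<in> chains_k F 0 d" by (simp add: chains_k_def z_def)
  have "z \<notin> boundaries_k F 0 d"
  proof
    assume "z \<in> boundaries_k F 0 d"
    then obtain w where w: "w \<in> chains_k F 1 d" and zw: "z = mat_k (bd F 0) *\<^sub>v w"
      unfolding boundaries_k_def bd_k_def One_nat_def by blast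
    \<comment> \<open>the lift of \<open>w\<close> to constant polynomials\<close>
    define w' where "w' = vec (rk F 1) (\<lambda>c. Poly_Mapping.single 0 (w $ c) :: ('v, 'k) mpoly)"
    define y where "y = bd F 0 *\<^sub>v w'"
    have w': "w' \<in> free_module V (rk F 1)" by (simp add: w'_def free_module_def polys_single)
    then have "y \<in> {v \<in> free_module V ?r. aug F \<bullet> v = 0}" unfolding ker y_def by blast
    then have y: "y \<in> carrier_vec ?r" "aug F \<bullet> y = 0" by (simp_all add: free_module_def)
    have y_hom: "homogeneous (d - degs F 0 ! e) (y $ e)" if e: "e < ?r" for e
    proof -
      have "y $ e = (\<Sum>i<rk F 1. bd F 0 $$ (e, i) * Poly_Mapping.single 0 (w $ i))"
        using e c by (auto simp: y_def w'_def scalar_prod_def atLeast0LessThan intro!: sum.cong)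
      moreover have "homogeneous (d - degs F 0 ! e) (bd F 0 $$ (e, i) * Poly_Mapping.single 0 (w $ i))"
        if i: "i < rk F 1" for i
      proof (cases "degs F 1 ! i = d")
        case True
        then have "homogeneous (d - degs F 0 ! e) (bd F 0 $$ (e, i))"
          using g e i by (auto simp: graded_mat_def)
        from homogeneous_mult[OF this homogeneous_single[of 0 0 "w $ i"]] show ?thesis by simp
      next
        case False
        then show ?thesis using w i by (simp add: chains_k_def)
      qed
      ultimately show ?thesis by (auto intro: homogeneous_sum)
    qed
    have y_const: "Poly_Mapping.lookup (y $ e) 0 = z $ e" if e: "e < ?r" for e
    proof -
      have "map_vec (\<lambda>p. Poly_Mapping.lookup p 0) y =
          mat_k (bd F 0) *\<^sub>v map_vec (\<lambda>p. Poly_Mapping.lookup p 0) w'"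
        unfolding y_def using w' by (intro const_term.mult_mat_vec_hom[OF c]) (simp add: free_module_def)
      also have "map_vec (\<lambda>p. Poly_Mapping.lookup p 0) w' = w"
        using w by (intro eq_vecI) (auto simp: w'_def chains_k_def)
      finally have "map_vec (\<lambda>p. Poly_Mapping.lookup p 0) y = z" by (simp add: zw)
      then show ?thesis using e y(1) by (metis carrier_vecD index_map_vec(1))
    qed
    have "u = (\<Sum>e<?r. v $ e * aug F $ e)"
      using v by (auto simp: scalar_prod_def free_module_def atLeast0LessThan mult.commute intro!: sum.cong)
    moreover have "hcomp d u = u" using u(2) by (simp add: hcomp_homogeneous)
    ultimately have "u = hcomp d (\<Sum>e<?r. v $ e * aug F $ e)" by simp
    also have "\<dots> = (\<Sum>e<?r. hcomp (d - degs F 0 ! e) (v $ e) * aug F $ e)"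
      unfolding hcomp_sum by (intro sum.cong refl hcomp_mult aug_hom) simp
    also have "\<dots> = (\<Sum>e<?r. aug F $ e * y $ e)"
    proof (rule sum.cong[OF refl])
      fix e assume "e \<in> {..<?r}"
      then have e: "e < ?r" by simp
      consider "degs F 0 ! e < d" | "degs F 0 ! e = d" | "degs F 0 ! e > d" by linarith
      then show "hcomp (d - degs F 0 ! e) (v $ e) * aug F $ e = aug F $ e * y $ e"
      proof cases
        case 1
        then show ?thesis using aug_low[OF e] by simp
      next
        case 2
        have "hcomp 0 (v $ e) = Poly_Mapping.single 0 (z $ e)"
          using homogeneous_deg0[OF homogeneous_hcomp[of 0 "v $ e"]] e 2 by (simp add: lookup_hcomp z_def)
        moreover have "y $ e = Poly_Mapping.single 0 (z $ e)"
          using homogeneous_deg0[of "y $ e"] y_hom[OF e] y_const[OF e] 2 by simp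
        ultimately show ?thesis using 2 by (simp add: mult.commute)
      next
        case 3
        then show ?thesis
          using homogeneous_neg[OF homogeneous_hcomp[of "d - degs F 0 ! e" "v $ e"]]
            homogeneous_neg[OF y_hom[OF e]] by simp
      qed
    qed
    also have "\<dots> = aug F \<bullet> y" using y(1) by (simp add: scalar_prod_def atLeast0LessThan)
    finally show False using y(2) u(3) by simp
  qed
  moreover have "boundaries_k F 0 d \<subseteq> chains_k F 0 d"
    using boundaries_k_subset_cycles_k[OF F, of 0 d] by (simp add: cycles_k_def)
  moreover have "bd_k F 0 \<in> carrier_mat ?r (rk F 1)" using c by (simp add: bd_k_def)
  note bk = this
  have chains_0: "0\<^sub>v (rk F i) \<in> chains_k F i d"
    and chains_add: "\<And>v w. v \<in> chains_k F i d \<Longrightarrow> w \<in> chains_k F i d \<Longrightarrow> v + w \<in> chains_k F i d"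
    and chains_smult: "\<And>a v. v \<in> chains_k F i d \<Longrightarrow> a \<cdot>\<^sub>v v \<in> chains_k F i d" for i
    by (auto simp: chains_k_def)
  have chains_c: "v \<in> chains_k F i d \<Longrightarrow> v \<in> carrier_vec (rk F i)" for v i by (simp add: chains_k_def)
  have "0\<^sub>v ?r \<in> boundaries_k F 0 d"
  proof -
    have "0\<^sub>v ?r = bd_k F 0 *\<^sub>v 0\<^sub>v (rk F 1)" using bk by (intro eq_vecI) auto
    then show ?thesis using chains_0[of 1] unfolding boundaries_k_def One_nat_def by blast
  qed
  moreover have "v + w \<in> boundaries_k F 0 d" if vw: "v \<in> boundaries_k F 0 d" "w \<in> boundaries_k F 0 d" for v w
  proof -
    obtain v' w' where v': "v' \<in> chains_k F 1 d" "v = bd_k F 0 *\<^sub>v v'"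
      and w': "w' \<in> chains_k F 1 d" "w = bd_k F 0 *\<^sub>v w'"
      using vw unfolding boundaries_k_def One_nat_def by blast
    have "v + w = bd_k F 0 *\<^sub>v (v' + w')"
      using mult_add_distrib_mat_vec[OF bk chains_c[OF v'(1)] chains_c[OF w'(1)]] v'(2) w'(2) by simp
    then show ?thesis using chains_add[OF v'(1) w'(1)] unfolding boundaries_k_def One_nat_def by blast
  qed
  moreover have "a \<cdot>\<^sub>v v \<in> boundaries_k F 0 d" if v: "v \<in> boundaries_k F 0 d" for a v
  proof -
    obtain v' where v': "v' \<in> chains_k F 1 d" "v = bd_k F 0 *\<^sub>v v'"
      using v unfolding boundaries_k_def One_nat_def by blast
    have "a \<cdot>\<^sub>v v = bd_k F 0 *\<^sub>v (a \<cdot>\<^sub>v v')"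
      using mult_mat_vec[OF bk chains_c[OF v'(1)]] v'(2) by simp
    then show ?thesis using chains_smult[OF v'(1)] unfolding boundaries_k_def One_nat_def by blast
  qed
  ultimately have "subspace_dim ?r (boundaries_k F 0 d) < subspace_dim ?r (chains_k F 0 d)"
    using z_chain chains_c[of _ 0] chains_0[of 0] chains_add[of _ 0] chains_smult[of _ 0]
    by (intro subspace_dim_strict_mono) auto
  then show ?thesis by (simp add: tor_dim_def cycles_k_def)
qed


section \<open>Polymatroidal sets of monomials\<close>

definition monomial_ideal :: "'v set \<Rightarrow> ('v \<Rightarrow>\<^sub>0 nat) set \<Rightarrow> ('v, 'k::field) mpoly set" where
  "monomial_ideal V B = {p \<in> polys V. \<forall>m\<in>Poly_Mapping.keys p. \<exists>b\<in>B. \<exists>c. m = c + b}"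

text \<open>
  The exchange property of the bases of a discrete polymatroid, with \<open>b'' = b x / v\<close> written
  without division.
\<close>

definition polymatroidal :: "('v \<Rightarrow>\<^sub>0 nat) set \<Rightarrow> bool" where
  "polymatroidal B \<longleftrightarrow> (\<forall>b\<in>B. \<forall>b'\<in>B. \<forall>v. Poly_Mapping.lookup b' v < Poly_Mapping.lookup b v \<longrightarrow>
     (\<exists>x. Poly_Mapping.lookup b x < Poly_Mapping.lookup b' x \<and>
        (\<exists>b''\<in>B. b'' + Poly_Mapping.single v 1 = b + Poly_Mapping.single x 1)))"

text \<open>
  The order on exponent lists is the lexicographic one, so it is decided at the first variable
  where the exponents differ.
\<close>

lemma map_lookup_less_iff:
  fixes a b :: "'v \<Rightarrow>\<^sub>0 nat"
  shows "map (Poly_Mapping.lookup a) vs < map (Poly_Mapping.lookup b) vs \<longleftrightarrow>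
    (\<exists>i<length vs. (\<forall>j<i. Poly_Mapping.lookup a (vs ! j) = Poly_Mapping.lookup b (vs ! j)) \<and>
      Poly_Mapping.lookup a (vs ! i) < Poly_Mapping.lookup b (vs ! i))"
proof -
  have *: "take i (map (Poly_Mapping.lookup a) vs) = take i (map (Poly_Mapping.lookup b) vs) \<longleftrightarrow>
      (\<forall>j<i. Poly_Mapping.lookup a (vs ! j) = Poly_Mapping.lookup b (vs ! j))" if "i < length vs" for i
    using that by (simp add: list_eq_iff_nth_eq)
  show ?thesis unfolding list_less_def lexord_take_index_conv using * by auto
qed

text \<open>
  Order the generators lexicographically by their exponents and let \<open>p b\<close> lie in the ideal of the
  predecessors of \<open>b\<close>.  A term \<open>m b\<close> of it is divisible by a predecessor \<open>b'\<close>.  Let \<open>v\<close> be the first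
  variable where \<open>b\<close> and \<open>b'\<close> differ; there \<open>b\<close> has the larger exponent.  Exchange gives a
  variable \<open>x\<close> with larger exponent in \<open>b'\<close>, which therefore divides \<open>m\<close>, such that \<open>b x / v\<close> is a
  generator.  It precedes \<open>b\<close> since \<open>x\<close> comes after \<open>v\<close>.  So \<open>x\<close> lies in the colon
  ideal.
\<close>

theorem polymatroidal_linear_quotients:
  fixes B :: "('v \<Rightarrow>\<^sub>0 nat) set"
  assumes V: "finite V" and B: "finite B" "\<And>b. b \<in> B \<Longrightarrow> Poly_Mapping.keys b \<subseteq> V"
    and pm: "polymatroidal B"
  shows "\<exists>bs. set bs = B \<and>
    linear_quotients V (\<lambda>s c. if c = 0 then monomial (bs ! s) else (0 :: ('v, 'k::field) mpoly)) (length bs)"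
proof -
  obtain vs where vs: "set vs = V" "distinct vs" using finite_distinct_list[OF V] by blast
  obtain bs0 where bs0: "set bs0 = B" "distinct bs0" using finite_distinct_list[OF B(1)] by blast
  \<comment> \<open>exponent lists, compared lexicographically\<close>
  define key where "key b = map (Poly_Mapping.lookup b) vs" for b :: "'v \<Rightarrow>\<^sub>0 nat"
  define bs where "bs = sort_key key bs0"
  have bs: "set bs = B" "distinct bs" "sorted (map key bs)"
    using bs0 by (simp_all add: bs_def)
  have key_inj: "b = b'" if "b \<in> B" "b' \<in> B" "key b = key b'" for b b'
  proof (rule poly_mapping_eqI)
    fix v
    show "Poly_Mapping.lookup b v = Poly_Mapping.lookup b' v"
    proof (cases "v \<in> V")
      case True
      then show ?thesis using that(3) vs(1) by (auto simp: key_def)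
    next
      case False
      then have "v \<notin> Poly_Mapping.keys b" "v \<notin> Poly_Mapping.keys b'" using that B(2) by blast+
      then show ?thesis by (simp add: in_keys_iff)
    qed
  qed
  have key_less: "key (bs ! t) < key (bs ! s)" if ts: "t < s" "s < length bs" for t s
  proof -
    have "key (bs ! t) \<le> key (bs ! s)" using sorted_nth_mono[OF bs(3), of t s] ts by simp
    moreover have "bs ! t \<noteq> bs ! s" using bs(2) ts by (simp add: nth_eq_iff_index_eq)
    then have "key (bs ! t) \<noteq> key (bs ! s)" using key_inj[of "bs ! t" "bs ! s"] bs(1) ts by auto
    ultimately show ?thesis by simp
  qed
  let ?m = "\<lambda>(s::nat) (c::nat). if c = 0 then monomial (bs ! s) else (0 :: ('v, 'k) mpoly)"
  have "linear_quotients V ?m (length bs)"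
    unfolding linear_quotients_def
  proof (intro allI impI)
    fix s assume s: "s < length bs"
    define b where "b = bs ! s"
    have bB: "b \<in> B" using s bs(1) by (auto simp: b_def)
    define X where "X = {x \<in> V. \<exists>t<s. \<exists>c. b + Poly_Mapping.single x 1 = c + bs ! t}"
    have "(\<lambda>c. p * ?m s c) \<in> spans V ?m s \<longleftrightarrow> p \<in> var_ideal X" if p: "p \<in> polys V" for p :: "('v, 'k) mpoly"
    proof
      assume "p \<in> var_ideal X"
      have "\<exists>c. (\<forall>t. c t \<in> polys V) \<and> p * monomial b = (\<Sum>t<s. c t * monomial (bs ! t))"
      proof (rule monomial_decomposition)
        show "p * monomial b \<in> polys V" using B(2)[OF bB] by (intro polys_mult p polys_single)
        fix m assume "m \<in> Poly_Mapping.keys (p * monomial b)"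
        then obtain m' where m': "m = m' + b" "m' \<in> Poly_Mapping.keys p"
          using keys_mult[of p "monomial b"] by auto
        then obtain x where x: "x \<in> Poly_Mapping.keys m'" "x \<in> X"
          using \<open>p \<in> var_ideal X\<close> unfolding var_ideal_def by blast
        from x(1) have "\<forall>v. Poly_Mapping.lookup (Poly_Mapping.single x 1) v \<le> Poly_Mapping.lookup m' v"
          by (auto simp: lookup_single when_def in_keys_iff)
        then obtain e where e: "m' = Poly_Mapping.single x 1 + e" by (auto simp flip: monomial_divides_iff)
        obtain t c where t: "t < s" "b + Poly_Mapping.single x 1 = c + bs ! t" using x(2) by (auto simp: X_def)
        have "m = e + (b + Poly_Mapping.single x 1)" by (simp add: m'(1) e ac_simps)
        then have "m = (e + c) + bs ! t" by (simp only: t(2) add.assoc)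
        then show "\<exists>i<s. \<exists>m'. m = m' + bs ! i" using t(1) by blast
      qed
      then obtain u where u: "\<And>t. u t \<in> polys V" "p * monomial b = (\<Sum>t<s. u t * monomial (bs ! t))"
        by blast
      show "(\<lambda>c. p * ?m s c) \<in> spans V ?m s"
      proof (rule spansI)
        show "p * ?m s c = (\<Sum>t<s. u t * ?m t c)" for c
          using u(2) by (simp add: b_def)
      qed (rule u(1))
    next
      assume "(\<lambda>c. p * ?m s c) \<in> spans V ?m s"
      then obtain u where u: "\<And>t. u t \<in> polys V" "\<And>c. p * ?m s c = (\<Sum>t<s. u t * ?m t c)"
        by (rule spansE) blast
      have e: "p * monomial b = (\<Sum>t<s. u t * monomial (bs ! t))" using u(2)[of 0] by (simp add: b_def)
      show "p \<in> var_ideal X"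
        unfolding var_ideal_def
      proof (rule CollectI, rule ballI)
        fix m assume "m \<in> Poly_Mapping.keys p"
        then have "m + b \<in> Poly_Mapping.keys (p * monomial b)" by (rule keys_mult_single) simp
        then obtain t where t: "t < s" "m + b \<in> Poly_Mapping.keys (u t * monomial (bs ! t))"
          unfolding e using keys_sum_subset[of "\<lambda>t. u t * monomial (bs ! t)" "{..<s}"] by blast
        then obtain m' where m': "m + b = m' + bs ! t"
          using keys_mult[of "u t" "monomial (bs ! t)"] by auto
        have tB: "bs ! t \<in> B" using t(1) s bs(1) by auto
        obtain i where i: "i < length vs"
          "\<And>j. j < i \<Longrightarrow> Poly_Mapping.lookup (bs ! t) (vs ! j) = Poly_Mapping.lookup b (vs ! j)"
          "Poly_Mapping.lookup (bs ! t) (vs ! i) < Poly_Mapping.lookup b (vs ! i)"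
          using key_less[OF t(1) s] unfolding key_def map_lookup_less_iff b_def by blast
        obtain x b'' where x: "Poly_Mapping.lookup b x < Poly_Mapping.lookup (bs ! t) x"
          and b'': "b'' \<in> B" "b'' + Poly_Mapping.single (vs ! i) 1 = b + Poly_Mapping.single x 1"
          using pm bB tB i(3) unfolding polymatroidal_def by blast
        have "x \<in> Poly_Mapping.keys (bs ! t)" using x by (simp add: in_keys_iff)
        then have xV: "x \<in> V" using B(2)[OF tB] by blast
        then obtain k where k: "k < length vs" "x = vs ! k" using vs(1) by (auto simp: in_set_conv_nth)
        have ki: "i < k"
        proof (rule ccontr)
          assume "\<not> i < k"
          then have "k < i \<or> k = i" by auto
          then show False using i(2)[of k] i(3) x k(2) by auto
        qed
        have lookup_b'': "Poly_Mapping.lookup b'' v + (if v = vs ! i then 1 else 0) =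
            Poly_Mapping.lookup b v + (if v = x then 1 else 0)" for v
          using arg_cong[OF b''(2), of "\<lambda>q. Poly_Mapping.lookup q v"]
          by (auto simp: lookup_add lookup_single when_def)
        have "key b'' < key b"
          unfolding key_def map_lookup_less_iff
        proof (intro exI[of _ i] conjI allI impI i(1))
          fix j assume j: "j < i"
          then have "vs ! j \<noteq> vs ! i" "vs ! j \<noteq> x"
            using vs(2) i(1) k ki by (simp_all add: nth_eq_iff_index_eq)
          then show "Poly_Mapping.lookup b'' (vs ! j) = Poly_Mapping.lookup b (vs ! j)"
            using lookup_b''[of "vs ! j"] by simp
        next
          have "vs ! i \<noteq> x" using vs(2) i(1) k ki by (simp add: nth_eq_iff_index_eq)
          then show "Poly_Mapping.lookup b'' (vs ! i) < Poly_Mapping.lookup b (vs ! i)"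
            using lookup_b''[of "vs ! i"] by simp
        qed
        obtain t' where t': "t' < length bs" "bs ! t' = b''"
          using b''(1) bs(1) by (auto simp: in_set_conv_nth)
        have "t' < s"
        proof (rule ccontr)
          assume "\<not> t' < s"
          then have "key b \<le> key b''" using sorted_nth_mono[OF bs(3), of s t'] t' s by (simp add: b_def)
          then show False using \<open>key b'' < key b\<close> by simp
        qed
        moreover have "b + Poly_Mapping.single x 1 = Poly_Mapping.single (vs ! i) 1 + bs ! t'"
          unfolding t'(2) using b''(2) by (simp add: add.commute)
        ultimately have "x \<in> X" using xV unfolding X_def by blast
        moreover have "x \<in> Poly_Mapping.keys m"
          using arg_cong[OF m', of "\<lambda>q. Poly_Mapping.lookup q x"] x by (simp add: lookup_add in_keys_iff)
        ultimately show "Poly_Mapping.keys m \<inter> X \<noteq> {}" by blast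
      qed
    qed
    moreover have "X \<subseteq> V" by (auto simp: X_def)
    ultimately show "\<exists>X\<subseteq>V. \<forall>p\<in>polys V. (\<lambda>c. p * ?m s c) \<in> spans V ?m s \<longleftrightarrow> p \<in> var_ideal X" by blast
  qed
  then show ?thesis using bs(1) by (intro exI[of _ bs] conjI)
qed

text \<open>
  The ideal is viewed as a module of vectors with the single coordinate 0.
\<close>

corollary polymatroidal_linear_resolution:
  fixes B :: "('v \<Rightarrow>\<^sub>0 nat) set"
  assumes V: "finite V" and B: "finite B" "\<And>b. b \<in> B \<Longrightarrow> Poly_Mapping.keys b \<subseteq> V"
    and pm: "polymatroidal B" and deg: "\<And>b. b \<in> B \<Longrightarrow> mon_degree b = d"
  shows "\<exists>F :: ('v, 'k::field) free_complex. graded_free_resolution V (monomial_ideal V B) F \<and>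
    (\<forall>i. \<forall>c < rk F i. degs F i ! c = int i + int d)"
proof -
  obtain bs where bs: "set bs = B"
    and lq: "linear_quotients V (\<lambda>s c. if c = 0 then monomial (bs ! s) else (0 :: ('v, 'k) mpoly)) (length bs)"
    using polymatroidal_linear_quotients[OF V B pm] by blast
  let ?m = "\<lambda>(s::nat) (c::nat). if c = 0 then monomial (bs ! s) else (0 :: ('v, 'k) mpoly)"
  have bsB: "bs ! s \<in> B" if "s < length bs" for s using that bs by auto
  have "{w 0 |w. w \<in> spans V ?m (length bs)} = monomial_ideal V B"
  proof (intro equalityI subsetI)
    fix p assume "p \<in> {w 0 |w. w \<in> spans V ?m (length bs)}"
    then obtain w where w: "w \<in> spans V ?m (length bs)" "p = w 0" by auto
    from w(1) obtain u where u: "\<And>t. u t \<in> polys V" "\<And>c. w c = (\<Sum>t<length bs. u t * ?m t c)"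
      by (rule spansE) blast
    have p: "p = (\<Sum>t<length bs. u t * monomial (bs ! t))" using u(2)[of 0] w(2) by simp
    have "p \<in> polys V" unfolding p using u(1) B(2)[OF bsB] by (intro polys_sum polys_mult polys_single) auto
    moreover have "\<exists>b\<in>B. \<exists>c. m = c + b" if m: "m \<in> Poly_Mapping.keys p" for m
    proof -
      obtain t where t: "t < length bs" "m \<in> Poly_Mapping.keys (u t * monomial (bs ! t))"
        using m keys_sum_subset[of "\<lambda>t. u t * monomial (bs ! t)" "{..<length bs}"] unfolding p by blast
      then obtain c where "m = c + bs ! t" using keys_mult[of "u t" "monomial (bs ! t)"] by auto
      then show ?thesis using bsB[OF t(1)] by blast
    qed
    ultimately show "p \<in> monomial_ideal V B" by (simp add: monomial_ideal_def)
  next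
    fix p :: "('v, 'k) mpoly" assume p: "p \<in> monomial_ideal V B"
    then have pV: "p \<in> polys V" by (simp add: monomial_ideal_def)
    have "\<exists>c. (\<forall>t. c t \<in> polys V) \<and> p = (\<Sum>t<length bs. c t * monomial (bs ! t))"
    proof (rule monomial_decomposition[OF pV])
      fix m assume "m \<in> Poly_Mapping.keys p"
      then obtain b c where "b \<in> B" "m = c + b" using p by (auto simp: monomial_ideal_def)
      moreover from this(1) obtain i where "i < length bs" "bs ! i = b"
        using bs by (auto simp: in_set_conv_nth)
      ultimately show "\<exists>i<length bs. \<exists>m'. m = m' + bs ! i" by blast
    qed
    then obtain u where u: "\<And>t. u t \<in> polys V" "p = (\<Sum>t<length bs. u t * monomial (bs ! t))" by blast
    have "(\<lambda>c. \<Sum>t<length bs. u t * ?m t c) \<in> spans V ?m (length bs)" by (rule spansI[OF u(1)]) simp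
    moreover have "p = (\<Sum>t<length bs. u t * ?m t 0)" using u(2) by simp
    ultimately show "p \<in> {w 0 |w. w \<in> spans V ?m (length bs)}"
      by (intro CollectI exI[of _ "\<lambda>c. \<Sum>t<length bs. u t * ?m t c"] conjI)
  qed
  moreover have "\<exists>F. graded_free_resolution V {w 0 |w. w \<in> spans V ?m (length bs)} F \<and>
    (\<forall>i. \<forall>c < rk F i. degs F i ! c = int i + int d)"
    using bsB B(2) deg
    by (intro linear_quotients_imp_linear_resolution[OF V lq]) (auto intro!: polys_single homogeneous_single)
  ultimately show ?thesis by simp
qed


section \<open>Products and powers of monomial ideals\<close>

lemma poly_ring_simps [simp]:
  "carrier (poly_ring V) = polys V" "mult (poly_ring V) = (*)" "one (poly_ring V) = 1"
  "zero (poly_ring V) = 0" "add (poly_ring V) = (+)"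
  by (simp_all add: poly_ring_def)

lemma cring_poly_ring: "cring (poly_ring V :: ('v, 'k::field) mpoly ring)"
proof (rule cringI)
  show "abelian_group (poly_ring V :: ('v, 'k) mpoly ring)"
  proof (rule abelian_groupI)
    fix x :: "('v, 'k) mpoly" assume "x \<in> carrier (poly_ring V)"
    then show "\<exists>y\<in>carrier (poly_ring V). y \<oplus>\<^bsub>poly_ring V\<^esub> x = \<zero>\<^bsub>poly_ring V\<^esub>"
      by (intro bexI[of _ "- x"]) (auto intro: polys_uminus)
  qed (auto intro: polys_add simp: add.assoc add.commute)
  show "Group.comm_monoid (poly_ring V :: ('v, 'k) mpoly ring)"
    by unfold_locales (auto intro: polys_mult simp: mult.assoc mult.commute)
qed (auto simp: distrib_right)

lemma a_inv_poly_ring: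
  assumes "p \<in> polys V" shows "a_inv (poly_ring V) p = - p"
proof -
  interpret cring "poly_ring V" by (rule cring_poly_ring)
  show ?thesis using assms polys_uminus[OF assms] by (intro minus_equality) auto
qed

lemma monomial_ideal_ideal: "ideal (monomial_ideal V B) (poly_ring V :: ('v, 'k::field) mpoly ring)"
proof -
  interpret cring "poly_ring V :: ('v, 'k) mpoly ring" by (rule cring_poly_ring)
  have mult: "p * q \<in> monomial_ideal V B" if p: "p \<in> polys V" and q: "q \<in> monomial_ideal V B"
    for p q :: "('v, 'k) mpoly"
  proof -
    have "\<exists>b\<in>B. \<exists>c. m = c + b" if mk: "m \<in> Poly_Mapping.keys (p * q)" for m
    proof -
      obtain m1 m2 where m: "m = m1 + m2" "m2 \<in> Poly_Mapping.keys q"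
        using mk keys_mult[of p q] by blast
      then obtain b c where "b \<in> B" "m2 = c + b" using q by (auto simp: monomial_ideal_def)
      then have "b \<in> B \<and> m = (m1 + c) + b" by (simp add: m(1) add.assoc)
      then show ?thesis by blast
    qed
    moreover have "p * q \<in> polys V" using p q by (simp add: monomial_ideal_def polys_mult)
    ultimately show ?thesis by (simp add: monomial_ideal_def)
  qed
  show ?thesis
  proof (rule idealI)
    show "ring (poly_ring V :: ('v, 'k) mpoly ring)" by (rule ring_axioms)
    show "subgroup (monomial_ideal V B) (add_monoid (poly_ring V :: ('v, 'k) mpoly ring))"
    proof (rule subgroup.intro)
      show "monomial_ideal V B \<subseteq> carrier (add_monoid (poly_ring V :: ('v, 'k) mpoly ring))"
        by (auto simp: monomial_ideal_def)
      fix x :: "('v, 'k) mpoly" assume x: "x \<in> monomial_ideal V B"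
      then have xV: "x \<in> polys V" by (simp add: monomial_ideal_def)
      have "- x \<in> monomial_ideal V B"
        using mult[OF polys_uminus[OF polys_1] x] by simp
      then show "m_inv (add_monoid (poly_ring V)) x \<in> monomial_ideal V B"
        using a_inv_poly_ring[OF xV] by (simp add: a_inv_def)
      fix y :: "('v, 'k) mpoly" assume y: "y \<in> monomial_ideal V B"
      have "x + y \<in> polys V" using xV y by (simp add: monomial_ideal_def polys_add)
      moreover have "\<exists>b\<in>B. \<exists>c. m = c + b" if "m \<in> Poly_Mapping.keys (x + y)" for m
        using that Poly_Mapping.keys_add[of x y] x y unfolding monomial_ideal_def by blast
      ultimately have "x + y \<in> monomial_ideal V B" by (simp add: monomial_ideal_def)
      then show "x \<otimes>\<^bsub>add_monoid (poly_ring V)\<^esub> y \<in> monomial_ideal V B" by simp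
    qed (simp add: monomial_ideal_def)
  next
    fix a x :: "('v, 'k) mpoly" assume "a \<in> monomial_ideal V B" "x \<in> carrier (poly_ring V)"
    then show "x \<otimes>\<^bsub>poly_ring V\<^esub> a \<in> monomial_ideal V B" "a \<otimes>\<^bsub>poly_ring V\<^esub> x \<in> monomial_ideal V B"
      using mult[of x a] by (simp_all add: mult.commute)
  qed
qed

lemma sum_of_terms_closed:
  fixes p :: "('v, 'k::field) mpoly"
  assumes zero: "0 \<in> J" and add: "\<And>p q. p \<in> J \<Longrightarrow> q \<in> J \<Longrightarrow> p + q \<in> J"
    and "\<And>m. m \<in> Poly_Mapping.keys p \<Longrightarrow> Poly_Mapping.single m (Poly_Mapping.lookup p m) \<in> J"
  shows "p \<in> J"
proof -
  have "(\<Sum>m\<in>K. Poly_Mapping.single m (Poly_Mapping.lookup p m)) \<in> J"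
    if "finite K" "K \<subseteq> Poly_Mapping.keys p" for K
    using that by (induction K rule: finite_induct) (auto intro: assms)
  from this[OF finite_keys subset_refl] show ?thesis by (simp flip: poly_eq_sum_monomials)
qed

lemma genideal_monomials:
  assumes B: "\<And>b. b \<in> B \<Longrightarrow> Poly_Mapping.keys b \<subseteq> V"
  shows "Idl\<^bsub>poly_ring V\<^esub> ((\<lambda>b. monomial b :: ('v, 'k::field) mpoly) ` B) = monomial_ideal V B"
proof
  interpret cring "poly_ring V :: ('v, 'k) mpoly ring" by (rule cring_poly_ring)
  have sub: "(\<lambda>b. monomial b :: ('v, 'k) mpoly) ` B \<subseteq> carrier (poly_ring V)"
    using B by (auto intro: polys_single)
  show "Idl\<^bsub>poly_ring V\<^esub> ((\<lambda>b. monomial b :: ('v, 'k) mpoly) ` B) \<subseteq> monomial_ideal V B"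
  proof (rule genideal_minimal[OF monomial_ideal_ideal])
    have "\<exists>b'\<in>B. \<exists>c. b = c + b'" if "b \<in> B" for b using that by (intro bexI[of _ b] exI[of _ 0]) auto
    then show "(\<lambda>b. monomial b :: ('v, 'k) mpoly) ` B \<subseteq> monomial_ideal V B"
      using B by (auto simp: monomial_ideal_def intro: polys_single)
  qed
  interpret I: ideal "Idl\<^bsub>poly_ring V\<^esub> ((\<lambda>b. monomial b :: ('v, 'k) mpoly) ` B)" "poly_ring V"
    by (rule genideal_ideal[OF sub])
  show "monomial_ideal V B \<subseteq> Idl\<^bsub>poly_ring V\<^esub> ((\<lambda>b. monomial b :: ('v, 'k) mpoly) ` B)"
  proof
    fix p :: "('v, 'k) mpoly" assume p: "p \<in> monomial_ideal V B"
    show "p \<in> Idl\<^bsub>poly_ring V\<^esub> ((\<lambda>b. monomial b :: ('v, 'k) mpoly) ` B)"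
    proof (rule sum_of_terms_closed)
      show "0 \<in> Idl\<^bsub>poly_ring V\<^esub> ((\<lambda>b. monomial b :: ('v, 'k) mpoly) ` B)"
        using I.zero_closed by simp
      show "p + q \<in> Idl\<^bsub>poly_ring V\<^esub> ((\<lambda>b. monomial b :: ('v, 'k) mpoly) ` B)"
        if "p \<in> Idl\<^bsub>poly_ring V\<^esub> ((\<lambda>b. monomial b :: ('v, 'k) mpoly) ` B)"
          "q \<in> Idl\<^bsub>poly_ring V\<^esub> ((\<lambda>b. monomial b :: ('v, 'k) mpoly) ` B)" for p q
        using I.a_closed[OF that] by simp
      fix m assume m: "m \<in> Poly_Mapping.keys p"
      then obtain b c where bc: "b \<in> B" "m = c + b" using p by (auto simp: monomial_ideal_def)
      have "Poly_Mapping.keys m \<subseteq> V" using p m by (auto simp: monomial_ideal_def polys_def)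
      then have "Poly_Mapping.single c (Poly_Mapping.lookup p m) \<in> carrier (poly_ring V)"
        by (simp add: bc(2) keys_add_nat polys_single)
      moreover have "monomial b \<in> Idl\<^bsub>poly_ring V\<^esub> ((\<lambda>b. monomial b :: ('v, 'k) mpoly) ` B)"
        using genideal_self[OF sub] bc(1) by blast
      ultimately have "Poly_Mapping.single c (Poly_Mapping.lookup p m) * monomial b
          \<in> Idl\<^bsub>poly_ring V\<^esub> ((\<lambda>b. monomial b :: ('v, 'k) mpoly) ` B)"
        using I.I_l_closed by fastforce
      then show "Poly_Mapping.single m (Poly_Mapping.lookup p m)
          \<in> Idl\<^bsub>poly_ring V\<^esub> ((\<lambda>b. monomial b :: ('v, 'k) mpoly) ` B)"
        by (simp add: mult_single bc(2))
    qed
  qed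
qed

lemma monomial_ideal_mult:
  "ideal_prod (poly_ring V) (monomial_ideal V A) (monomial_ideal V B) =
    (monomial_ideal V {a + b |a b. a \<in> A \<and> b \<in> B} :: ('v, 'k::field) mpoly set)" (is "?L = ?R")
proof
  show "?L \<subseteq> ?R"
  proof
    fix p assume "p \<in> ?L"
    then show "p \<in> ?R"
    proof induction
      case (prod i j)
      have "\<exists>e\<in>{a + b |a b. a \<in> A \<and> b \<in> B}. \<exists>c. m = c + e" if mk: "m \<in> Poly_Mapping.keys (i * j)" for m
      proof -
        obtain m1 m2 where m: "m = m1 + m2" "m1 \<in> Poly_Mapping.keys i" "m2 \<in> Poly_Mapping.keys j"
          using mk keys_mult[of i j] by blast
        obtain a c where a: "a \<in> A" "m1 = c + a" using prod(1) m(2) by (auto simp: monomial_ideal_def)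
        obtain b c' where b: "b \<in> B" "m2 = c' + b" using prod(2) m(3) by (auto simp: monomial_ideal_def)
        have "m = (c + c') + (a + b)" by (simp add: m(1) a(2) b(2) ac_simps)
        then show ?thesis using a(1) b(1) by blast
      qed
      moreover have "i * j \<in> polys V" using prod by (simp add: monomial_ideal_def polys_mult)
      ultimately show ?case by (simp add: monomial_ideal_def)
    next
      case (sum p q)
      then show ?case
        using additive_subgroup.a_closed[OF ideal.axioms(1)[OF monomial_ideal_ideal], of p V _ q] by simp
    qed
  qed
  show "?R \<subseteq> ?L"
  proof
    fix p :: "('v, 'k) mpoly" assume p: "p \<in> ?R"
    show "p \<in> ?L"
    proof (rule sum_of_terms_closed)
      show "0 \<in> ?L" using ideal_prod.prod[of 0 "monomial_ideal V A" 0 "monomial_ideal V B" "poly_ring V"]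
        by (simp add: monomial_ideal_def)
      show "p + q \<in> ?L" if "p \<in> ?L" "q \<in> ?L" for p q
        using ideal_prod.sum[OF that] by simp
      fix m assume m: "m \<in> Poly_Mapping.keys p"
      then obtain a b c where abc: "a \<in> A" "b \<in> B" "m = c + (a + b)"
        using p unfolding monomial_ideal_def by blast
      have mV: "Poly_Mapping.keys m \<subseteq> V" using p m by (auto simp: monomial_ideal_def polys_def)
      have 1: "Poly_Mapping.single (c + a) (Poly_Mapping.lookup p m) \<in> monomial_ideal V A"
        using mV abc by (auto simp: monomial_ideal_def keys_add_nat intro!: polys_single)
      have 2: "monomial b \<in> monomial_ideal V B"
        using mV abc by (auto simp: monomial_ideal_def keys_add_nat intro!: polys_single bexI[of _ b] exI[of _ 0])
      from ideal_prod.prod[OF 1 2, of "poly_ring V"]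
      show "Poly_Mapping.single m (Poly_Mapping.lookup p m) \<in> ?L"
        by (simp add: mult_single abc(3) add.assoc)
    qed
  qed
qed

text \<open>
  The monoid of ideals has the whole ring as its unit, so the zeroth power is \<open>k[V]\<close>.
\<close>

lemma ideal_power_simps:
  "ideal_power V L 0 = polys V"
  "ideal_power V L (Suc n) = ideal_prod (poly_ring V) (ideal_power V L n) L"
  by (simp_all add: ideal_power_def nat_pow_def ideals_set_def)


section \<open>Edge monomials of complete multipartite graphs\<close>

text \<open>
  The map \<open>\<pi>\<close> names the part of each vertex of a complete multipartite graph on \<open>V\<close>.
\<close>

definition part_degree :: "'v set \<Rightarrow> ('v \<Rightarrow> 'c) \<Rightarrow> 'c \<Rightarrow> ('v \<Rightarrow>\<^sub>0 nat) \<Rightarrow> nat" where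
  "part_degree V \<pi> c m = (\<Sum>v\<in>{v \<in> V. \<pi> v = c}. Poly_Mapping.lookup m v)"

definition edge_power_monomials :: "'v set \<Rightarrow> ('v \<Rightarrow> 'c) \<Rightarrow> nat \<Rightarrow> ('v \<Rightarrow>\<^sub>0 nat) set" where
  "edge_power_monomials V \<pi> n =
     {m. Poly_Mapping.keys m \<subseteq> V \<and> mon_degree m = 2 * n \<and> (\<forall>c. part_degree V \<pi> c m \<le> n)}"

lemma part_degree_add: "part_degree V \<pi> c (a + b) = part_degree V \<pi> c a + part_degree V \<pi> c b"
  by (simp add: part_degree_def lookup_add sum.distrib)

lemma part_degree_single:
  assumes "finite V" "x \<in> V"
  shows "part_degree V \<pi> c (Poly_Mapping.single x 1) = (if \<pi> x = c then 1 else 0)"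
  using assms by (auto simp: part_degree_def lookup_single when_def)

lemma mon_degree_eq_sum_part_degree:
  assumes "finite V" "Poly_Mapping.keys m \<subseteq> V"
  shows "mon_degree m = (\<Sum>c\<in>\<pi> ` V. part_degree V \<pi> c m)"
  unfolding part_degree_def mon_degree_superset[OF assms] by (rule sum.image_gen[OF assms(1)])

lemma part_degree_pos:
  assumes "part_degree V \<pi> c m > 0"
  obtains x where "x \<in> V" "\<pi> x = c" "Poly_Mapping.lookup m x > 0"
proof -
  have "(\<Sum>v\<in>{v \<in> V. \<pi> v = c}. Poly_Mapping.lookup m v) \<noteq> 0" using assms by (simp add: part_degree_def)
  then obtain x where "x \<in> {v \<in> V. \<pi> v = c}" "Poly_Mapping.lookup m x \<noteq> 0" by (meson sum.neutral)
  then show ?thesis using that[of x] by simp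
qed

text \<open>
  Let \<open>b\<close> have the larger exponent at \<open>v\<close>.  If some \<open>x\<close> in the part of \<open>v\<close> has a larger exponent in
  \<open>b'\<close>, exchanging \<open>v\<close> for \<open>x\<close> keeps all part degrees.  Otherwise \<open>b'\<close> has the smaller degree in
  that part.  Since the total degrees agree, it has a larger degree in some other part, where \<open>b\<close>
  has degree below \<open>n\<close> and thus room for a further variable.
\<close>

lemma polymatroidal_edge_power_monomials:
  assumes V: "finite V"
  shows "polymatroidal (edge_power_monomials V \<pi> n)"
  unfolding polymatroidal_def
proof (intro ballI allI impI)
  fix b b' v
  assume b: "b \<in> edge_power_monomials V \<pi> n" and b': "b' \<in> edge_power_monomials V \<pi> n"
    and less: "Poly_Mapping.lookup b' v < Poly_Mapping.lookup b v"
  have bV: "Poly_Mapping.keys b \<subseteq> V" "Poly_Mapping.keys b' \<subseteq> V"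
    using b b' by (simp_all add: edge_power_monomials_def)
  have "v \<in> Poly_Mapping.keys b" using less by (simp add: in_keys_iff)
  then have vV: "v \<in> V" using bV by blast
  let ?goal = "\<exists>x. Poly_Mapping.lookup b x < Poly_Mapping.lookup b' x \<and>
     (\<exists>b''\<in>edge_power_monomials V \<pi> n. b'' + Poly_Mapping.single v 1 = b + Poly_Mapping.single x 1)"
  have exchange: ?goal
    if x: "x \<in> V" "Poly_Mapping.lookup b x < Poly_Mapping.lookup b' x"
      and deg: "\<pi> x = \<pi> v \<or> part_degree V \<pi> (\<pi> x) b < n" for x
  proof -
    have "\<forall>u. Poly_Mapping.lookup (Poly_Mapping.single v 1) u \<le>
        Poly_Mapping.lookup (b + Poly_Mapping.single x 1) u"
      using less by (auto simp: lookup_single lookup_add when_def)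
    then obtain b'' where "b + Poly_Mapping.single x 1 = Poly_Mapping.single v 1 + b''"
      by (auto simp flip: monomial_divides_iff)
    then have e: "b'' + Poly_Mapping.single v 1 = b + Poly_Mapping.single x 1" by (simp add: add.commute)
    have "Poly_Mapping.keys b'' \<subseteq> V"
      using arg_cong[OF e, of Poly_Mapping.keys] bV x(1) by (auto simp: keys_add_nat)
    moreover have "mon_degree b'' = 2 * n"
      using arg_cong[OF e, of mon_degree] b by (simp add: mon_degree_add edge_power_monomials_def)
    moreover have "part_degree V \<pi> c b'' \<le> n" for c
    proof -
      have "part_degree V \<pi> c b'' + (if \<pi> v = c then 1 else 0) =
          part_degree V \<pi> c b + (if \<pi> x = c then 1 else 0)"
        using arg_cong[OF e, of "part_degree V \<pi> c"] part_degree_single[OF V vV, of \<pi> c]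
          part_degree_single[OF V x(1), of \<pi> c] by (simp only: part_degree_add)
      moreover have "part_degree V \<pi> c b \<le> n" using b by (simp add: edge_power_monomials_def)
      ultimately show ?thesis using deg by (auto split: if_splits)
    qed
    ultimately have "b'' \<in> edge_power_monomials V \<pi> n" by (simp add: edge_power_monomials_def)
    with e x(2) show ?goal by blast
  qed
  let ?C = "\<lambda>c. {u \<in> V. \<pi> u = c}"
  show ?goal
  proof (cases "\<exists>x\<in>?C (\<pi> v). Poly_Mapping.lookup b x < Poly_Mapping.lookup b' x")
    case True
    then show ?thesis using exchange by blast
  next
    case False
    have lt: "part_degree V \<pi> (\<pi> v) b' < part_degree V \<pi> (\<pi> v) b"
      unfolding part_degree_def
    proof (rule sum_strict_mono_ex1)
      show "\<forall>u\<in>?C (\<pi> v). Poly_Mapping.lookup b' u \<le> Poly_Mapping.lookup b u"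
        using False by (meson not_less)
      show "\<exists>u\<in>?C (\<pi> v). Poly_Mapping.lookup b' u < Poly_Mapping.lookup b u"
        using less vV by blast
    qed (use V in simp)
    have "\<exists>c\<in>\<pi> ` V. part_degree V \<pi> c b < part_degree V \<pi> c b'"
    proof (rule ccontr)
      assume "\<not> ?thesis"
      then have le: "\<forall>c\<in>\<pi> ` V. part_degree V \<pi> c b' \<le> part_degree V \<pi> c b" by (meson not_less)
      have "(\<Sum>c\<in>\<pi> ` V. part_degree V \<pi> c b') < (\<Sum>c\<in>\<pi> ` V. part_degree V \<pi> c b)"
        by (rule sum_strict_mono_ex1) (use V le lt vV in auto)
      then show False
        using mon_degree_eq_sum_part_degree[OF V bV(1), of \<pi>] mon_degree_eq_sum_part_degree[OF V bV(2), of \<pi>]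
          b b' by (simp add: edge_power_monomials_def)
    qed
    then obtain c where c: "part_degree V \<pi> c b < part_degree V \<pi> c b'" by blast
    have "\<exists>x\<in>?C c. Poly_Mapping.lookup b x < Poly_Mapping.lookup b' x"
    proof (rule ccontr)
      assume "\<not> ?thesis"
      then have "part_degree V \<pi> c b' \<le> part_degree V \<pi> c b"
        unfolding part_degree_def by (intro sum_mono) (meson not_less)
      then show False using c by simp
    qed
    then obtain x where x: "x \<in> V" "\<pi> x = c" "Poly_Mapping.lookup b x < Poly_Mapping.lookup b' x" by blast
    moreover have "part_degree V \<pi> c b' \<le> n" using b' by (simp add: edge_power_monomials_def)
    ultimately show ?thesis using exchange[OF x(1,3)] c by simp
  qed
qed

lemma ex_max_of_finite:
  fixes f :: "'a \<Rightarrow> nat"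
  assumes "finite S" "S \<noteq> {}" shows "\<exists>x\<in>S. \<forall>y\<in>S. f y \<le> f x"
proof -
  have "Max (f ` S) \<in> f ` S" using assms by (intro Max_in) auto
  then obtain x where "x \<in> S" "f x = Max (f ` S)" by auto
  then show ?thesis using assms by (intro bexI[of _ x]) auto
qed

definition edge_monomials :: "'v set \<Rightarrow> ('v \<Rightarrow> 'c) \<Rightarrow> ('v \<Rightarrow>\<^sub>0 nat) set" where
  "edge_monomials V \<pi> = {Poly_Mapping.single x 1 + Poly_Mapping.single y 1 |x y. x \<in> V \<and> y \<in> V \<and> \<pi> x \<noteq> \<pi> y}"

lemma edge_power_monomials_0: "edge_power_monomials V \<pi> 0 = {0}"
  by (auto simp: edge_power_monomials_def part_degree_def)

text \<open>
  To split an edge off \<open>m\<close>, take a variable from a part of largest degree and one from a part of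
  second largest degree.  A third part of degree \<open>n + 1\<close> would force the total degree to be at
  least \<open>3(n + 1)\<close>, so all part degrees of the remaining monomial are at most \<open>n\<close>.
\<close>

lemma edge_power_monomials_Suc:
  assumes V: "finite V"
  shows "edge_power_monomials V \<pi> (Suc n) =
    {a + e |a e. a \<in> edge_power_monomials V \<pi> n \<and> e \<in> edge_monomials V \<pi>}"
proof (intro equalityI subsetI)
  fix m assume "m \<in> {a + e |a e. a \<in> edge_power_monomials V \<pi> n \<and> e \<in> edge_monomials V \<pi>}"
  then obtain a x y where a: "a \<in> edge_power_monomials V \<pi> n" and xy: "x \<in> V" "y \<in> V" "\<pi> x \<noteq> \<pi> y"
    and m: "m = a + (Poly_Mapping.single x 1 + Poly_Mapping.single y 1)"
    unfolding edge_monomials_def by blast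
  have "part_degree V \<pi> c m \<le> Suc n" for c
  proof -
    have "part_degree V \<pi> c a \<le> n" using a by (simp add: edge_power_monomials_def)
    moreover have "part_degree V \<pi> c m =
        part_degree V \<pi> c a + ((if \<pi> x = c then 1 else 0) + (if \<pi> y = c then 1 else 0))"
      unfolding m part_degree_add part_degree_single[OF V xy(1)] part_degree_single[OF V xy(2)] ..
    ultimately show ?thesis using xy(3) by (auto split: if_splits)
  qed
  then show "m \<in> edge_power_monomials V \<pi> (Suc n)"
    using a xy by (auto simp: m edge_power_monomials_def mon_degree_add keys_add_nat)
next
  fix m assume m: "m \<in> edge_power_monomials V \<pi> (Suc n)"
  then have mV: "Poly_Mapping.keys m \<subseteq> V" and deg: "mon_degree m = 2 * Suc n"
    and le: "\<And>c. part_degree V \<pi> c m \<le> Suc n" by (simp_all add: edge_power_monomials_def)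
  let ?d = "\<lambda>c. part_degree V \<pi> c m"
  let ?S = "\<pi> ` V"
  have fin: "finite ?S" using V by simp
  have total: "(\<Sum>c\<in>?S. ?d c) = 2 * Suc n"
    using mon_degree_eq_sum_part_degree[OF V mV, of \<pi>] deg by simp
  then have "?S \<noteq> {}" by auto
  then obtain q1 where q1: "q1 \<in> ?S" "\<forall>c\<in>?S. ?d c \<le> ?d q1" using ex_max_of_finite[OF fin, of ?d] by blast
  have rest: "?d q1 + (\<Sum>c\<in>?S - {q1}. ?d c) = 2 * Suc n"
    using sum.remove[OF fin q1(1), of ?d] total by simp
  then have "(\<Sum>c\<in>?S - {q1}. ?d c) \<noteq> 0" using le[of q1] by simp
  then have "?S - {q1} \<noteq> {}" by (metis sum.empty)
  then obtain q2 where q2: "q2 \<in> ?S - {q1}" "\<forall>c\<in>?S - {q1}. ?d c \<le> ?d q2"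
    using ex_max_of_finite[of "?S - {q1}" ?d] fin by blast
  have q2_pos: "?d q2 > 0"
  proof (rule ccontr)
    assume "\<not> ?d q2 > 0"
    then have "\<forall>c\<in>?S - {q1}. ?d c = 0" using q2(2) by auto
    then show False using \<open>(\<Sum>c\<in>?S - {q1}. ?d c) \<noteq> 0\<close> by (metis sum.neutral)
  qed
  have "?d q1 > 0" using q1(2) q2(1) q2_pos by (metis DiffD1 less_le_trans)
  then obtain x where x: "x \<in> V" "\<pi> x = q1" "Poly_Mapping.lookup m x > 0" by (rule part_degree_pos)
  obtain y where y: "y \<in> V" "\<pi> y = q2" "Poly_Mapping.lookup m y > 0" using q2_pos by (rule part_degree_pos)
  have neq: "q1 \<noteq> q2" using q2(1) by blast
  then have "x \<noteq> y" using x(2) y(2) by blast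
  let ?e = "Poly_Mapping.single x 1 + Poly_Mapping.single y 1 :: 'a \<Rightarrow>\<^sub>0 nat"
  have "\<forall>u. Poly_Mapping.lookup ?e u \<le> Poly_Mapping.lookup m u"
    using \<open>x \<noteq> y\<close> x(3) y(3) by (auto simp: lookup_add lookup_single when_def)
  then obtain a where a: "m = ?e + a" by (auto simp flip: monomial_divides_iff)
  have "part_degree V \<pi> c a \<le> n" for c
  proof -
    have e: "?d c = ((if q1 = c then 1 else 0) + (if q2 = c then 1 else 0)) + part_degree V \<pi> c a"
      unfolding a part_degree_add part_degree_single[OF V x(1)] part_degree_single[OF V y(1)] x(2) y(2) ..
    consider "c = q1 \<or> c = q2" | "c \<noteq> q1" "c \<noteq> q2" "c \<in> ?S" | "c \<notin> ?S" by blast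
    then show ?thesis
    proof cases
      case 1
      then show ?thesis using e le[of c] neq by auto
    next
      case 2
      have "?d c \<noteq> Suc n"
      proof
        assume "?d c = Suc n"
        moreover have "?d c \<le> ?d q2" "?d c \<le> ?d q1" using 2 q1(2) q2(2) by auto
        moreover have "?d c + ?d q2 \<le> (\<Sum>c\<in>?S - {q1}. ?d c)"
          using sum_mono2[of "?S - {q1}" "{c, q2}" ?d] fin 2 q2(1) by simp
        ultimately show False using rest by simp
      qed
      then show ?thesis using e le[of c] 2 by simp
    next
      case 3
      then have "{v \<in> V. \<pi> v = c} = {}" by blast
      then have "part_degree V \<pi> c a = 0" unfolding part_degree_def by (metis sum.empty)
      then show ?thesis by simp
    qed
  qed
  moreover have "Poly_Mapping.keys a \<subseteq> V" using mV by (auto simp: a keys_add_nat)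
  moreover have "mon_degree a = 2 * n" using deg by (simp add: a mon_degree_add)
  ultimately have "a \<in> edge_power_monomials V \<pi> n" by (simp add: edge_power_monomials_def)
  moreover have "?e \<in> edge_monomials V \<pi>" using x y neq unfolding edge_monomials_def by blast
  moreover have "m = a + ?e" by (simp add: a add.commute)
  ultimately show "m \<in> {a + e |a e. a \<in> edge_power_monomials V \<pi> n \<and> e \<in> edge_monomials V \<pi>}" by blast
qed

lemma ideal_power_edge_monomials:
  assumes "finite V"
  shows "ideal_power V (monomial_ideal V (edge_monomials V \<pi>)) n =
    (monomial_ideal V (edge_power_monomials V \<pi> n) :: ('v, 'k::field) mpoly set)"
proof (induction n)
  case 0
  show ?case by (auto simp: ideal_power_simps edge_power_monomials_0 monomial_ideal_def)
next
  case (Suc n)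
  then show ?case
    by (simp add: ideal_power_simps monomial_ideal_mult edge_power_monomials_Suc[OF assms])
qed


section \<open>Powers of edge ideals of complete multipartite graphs\<close>

lemma finite_monomials_of_degree:
  assumes "finite V" shows "finite {m. Poly_Mapping.keys m \<subseteq> V \<and> mon_degree m = d}"
proof (rule finite_imageD)
  let ?M = "{m. Poly_Mapping.keys m \<subseteq> V \<and> mon_degree m = d}"
  have le: "Poly_Mapping.lookup m v \<le> d" if "m \<in> ?M" for m v
  proof (cases "v \<in> Poly_Mapping.keys m")
    case True
    then have "Poly_Mapping.lookup m v \<le> mon_degree m" unfolding mon_degree_def by (intro member_le_sum) auto
    then show ?thesis using that by simp
  qed (simp add: in_keys_iff)
  show "finite (Poly_Mapping.lookup ` ?M)"
  proof (rule finite_subset)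
    show "Poly_Mapping.lookup ` ?M \<subseteq> {f. \<forall>v. (v \<in> V \<longrightarrow> f v \<in> {..d}) \<and> (v \<notin> V \<longrightarrow> f v = 0)}"
      using le by (auto simp: in_keys_iff subset_iff)
    show "finite {f. \<forall>v. (v \<in> V \<longrightarrow> f v \<in> {..d}) \<and> (v \<notin> V \<longrightarrow> f v = (0::nat))}"
      using assms by (intro finite_set_of_finite_funs) auto
  qed
  show "inj_on Poly_Mapping.lookup ?M" by (rule inj_onI) (simp only: poly_mapping_eq_iff)
qed

text \<open>
  The Betti numbers are defined from a chosen resolution; it need not be \<open>G\<close>, so both halves rest
  on the results for arbitrary resolutions.
\<close>

theorem linear_resolution_imp_betti:
  fixes L :: "('v, 'k::field) mpoly set"
  assumes G: "graded_free_resolution V L G" and degs: "\<And>i c. c < rk G i \<Longrightarrow> degs G i ! c = int i + int d"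
    and low: "\<And>p m. p \<in> L \<Longrightarrow> m \<in> Poly_Mapping.keys p \<Longrightarrow> d \<le> mon_degree m"
    and u: "u \<in> L" "homogeneous (int d) u" "u \<noteq> 0"
  shows "has_linear_resolution V d L" and "regularity V L = int d"
proof -
  define F where "F = (SOME F. graded_free_resolution V L F)"
  have F: "graded_free_resolution V L F" unfolding F_def using G by (rule someI)
  have betti: "graded_betti V L i j = tor_dim F i j" for i j by (simp add: graded_betti_def F_def)
  have vanish: "graded_betti V L i j = 0" if "j \<noteq> int i + int d" for i j
    unfolding betti using that degs by (intro tor_dim_eq_0[OF F G]) auto
  then show "has_linear_resolution V d L" by (simp add: has_linear_resolution_def)
  have "graded_betti V L 0 (int d) \<noteq> 0"
    unfolding betti using low u by (intro tor_dim_initial_degree[OF F]) auto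
  then have nz: "\<exists>i j. int d = j - int i \<and> graded_betti V L i j \<noteq> 0"
    by (intro exI[of _ 0] exI[of _ "int d"]) simp
  have "j - int i = int d" if "graded_betti V L i j \<noteq> 0" for i j
    using vanish[of j i] that by force
  with nz have "{j - int i |i j. graded_betti V L i j \<noteq> 0} = {int d}" by blast
  then show "regularity V L = int d" by (simp add: regularity_def)
qed

text \<open>
  Two vertices in different parts guarantee an edge, so that the powers are nonzero and the
  regularity is the maximum of a nonempty set.
\<close>

theorem powers_of_multipartite_edge_ideal:
  fixes V :: "'v set" and \<pi> :: "'v \<Rightarrow> 'c" and n :: nat
  assumes V: "finite V" and xy: "x \<in> V" "y \<in> V" "\<pi> x \<noteq> \<pi> y"
  defines "L \<equiv> ideal_power V (monomial_ideal V (edge_monomials V \<pi>) :: ('v, 'k::field) mpoly set) n"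
  shows "has_linear_resolution V (2 * n) L" and "regularity V L = int (2 * n)"
proof -
  let ?B = "edge_power_monomials V \<pi> n"
  have L: "L = monomial_ideal V ?B" unfolding L_def by (rule ideal_power_edge_monomials[OF V])
  have BV: "Poly_Mapping.keys b \<subseteq> V" and Bd: "mon_degree b = 2 * n" if "b \<in> ?B" for b
    using that by (simp_all add: edge_power_monomials_def)
  have "finite ?B" using finite_monomials_of_degree[OF V, of "2 * n"]
    by (rule rev_finite_subset) (auto simp: edge_power_monomials_def)
  from polymatroidal_linear_resolution[OF V this BV polymatroidal_edge_power_monomials[OF V] Bd]
  obtain G :: "('v, 'k) free_complex" where G: "graded_free_resolution V L G"
    "\<And>i c. c < rk G i \<Longrightarrow> degs G i ! c = int i + int (2 * n)" unfolding L by blast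
  have low: "2 * n \<le> mon_degree m" if "p \<in> L" "m \<in> Poly_Mapping.keys p" for p m
    using that Bd by (fastforce simp: L monomial_ideal_def mon_degree_add)
  have "\<exists>b. b \<in> edge_power_monomials V \<pi> k" for k
  proof (induction k)
    case 0
    show ?case by (simp add: edge_power_monomials_0)
  next
    case (Suc k)
    then show ?case using xy unfolding edge_power_monomials_Suc[OF V] edge_monomials_def by blast
  qed
  then obtain b where b: "b \<in> ?B" by blast
  have u1: "monomial b \<in> L" using BV[OF b] b
    by (auto simp: L monomial_ideal_def intro!: polys_single bexI[of _ b] exI[of _ 0])
  have u2: "homogeneous (int (2 * n)) (monomial b :: ('v, 'k) mpoly)"
    using Bd[OF b] by (intro homogeneous_single) simp
  have u3: "(monomial b :: ('v, 'k) mpoly) \<noteq> 0"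
    by (metis lookup_single_eq lookup_zero one_neq_zero)
  show "has_linear_resolution V (2 * n) L"
    by (rule linear_resolution_imp_betti(1)[OF G low u1 u2 u3])
  show "regularity V L = int (2 * n)"
    by (rule linear_resolution_imp_betti(2)[OF G low u1 u2 u3])
qed

lemma edge_ideal_multipartite:
  fixes V :: "'v set" and E :: "'v set set"
  assumes "\<And>x y. {x, y} \<in> E \<longleftrightarrow> x \<in> V \<and> y \<in> V \<and> \<pi> x \<noteq> \<pi> y"
  shows "(edge_ideal (V, E) :: ('v, 'k::field) mpoly set) = monomial_ideal V (edge_monomials V \<pi>)"
proof -
  have "{mvar x * mvar y |x y. {x, y} \<in> E} = (\<lambda>b. monomial b :: ('v, 'k) mpoly) ` edge_monomials V \<pi>"
    by (auto simp: assms edge_monomials_def mvar_def mult_single image_iff)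
  moreover have "Poly_Mapping.keys b \<subseteq> V" if "b \<in> edge_monomials V \<pi>" for b
    using that by (auto simp: edge_monomials_def keys_add_nat)
  ultimately show ?thesis by (simp add: edge_ideal_def genideal_monomials)
qed


section \<open>The prime ideal graph\<close>

text \<open>
  The elements of \<open>P\<close> are parts of their own, and \<open>None\<close> names the part of all other
  vertices.
\<close>

lemma prime_ideal_graph_edge_iff:
  assumes P: "primeideal P R" and x: "x \<in> carrier R - {\<zero>\<^bsub>R\<^esub>}" and y: "y \<in> carrier R - {\<zero>\<^bsub>R\<^esub>}"
  shows "x \<noteq> y \<and> x \<otimes>\<^bsub>R\<^esub> y \<in> P \<longleftrightarrow>
    (if x \<in> P then Some x else None) \<noteq> (if y \<in> P then Some y else None)"
proof -
  interpret primeideal P R by (rule P)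
  have "x \<otimes>\<^bsub>R\<^esub> y \<in> P \<longleftrightarrow> x \<in> P \<or> y \<in> P"
    using I_prime[of x y] I_l_closed[of y x] I_r_closed[of x y] x y by auto
  then show ?thesis by auto
qed

theorem corollary6p6:
  fixes R :: "('r, 'b) ring_scheme" and P :: "'r set"
    and V :: "'r set" and I :: "('r, 'k::field) mpoly set"
  assumes "cring R" and "finite (carrier R)"
    and "primeideal P R" and "card P \<ge> 2"
    and "V = carrier R - {\<zero>\<^bsub>R\<^esub>}"
    and "I = edge_ideal (prime_ideal_graph R P)"
  shows "(\<forall>n \<ge> 1. has_linear_resolution V (2 * n) (ideal_power V I n) \<and>
                   regularity V (ideal_power V I n) = 2 * int n) \<and>
         has_linear_powers V I"
proof -
  interpret primeideal P R by (rule assms(3))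
  let ?\<pi> = "\<lambda>x. if x \<in> P then Some x else None"
  define E where "E = snd (prime_ideal_graph R P)"
  have G: "prime_ideal_graph R P = (V, E)" by (simp add: E_def prime_ideal_graph_def assms(5))
  have "{x, y} \<in> E \<longleftrightarrow> x \<in> V \<and> y \<in> V \<and> ?\<pi> x \<noteq> ?\<pi> y" for x y
  proof -
    have "{x, y} \<in> E \<longleftrightarrow> x \<in> V \<and> y \<in> V \<and> x \<noteq> y \<and> x \<otimes>\<^bsub>R\<^esub> y \<in> P"
      using m_comm[of x y]
      by (auto simp: E_def prime_ideal_graph_def assms(5) doubleton_eq_iff)
    then show ?thesis using prime_ideal_graph_edge_iff[OF assms(3), of x y] assms(5) by blast
  qed
  then have I: "I = monomial_ideal V (edge_monomials V ?\<pi>)"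
    unfolding assms(6) G by (rule edge_ideal_multipartite)
  have V: "finite V" using assms(2,5) by simp
  have "P \<noteq> {\<zero>\<^bsub>R\<^esub>}" using assms(4) by auto
  moreover have "\<zero>\<^bsub>R\<^esub> \<in> P" by simp
  ultimately obtain u where u: "u \<in> P" "u \<noteq> \<zero>\<^bsub>R\<^esub>" by blast
  have one: "\<one>\<^bsub>R\<^esub> \<notin> P" using one_imp_carrier I_notcarr by blast
  have "u \<in> V" "\<one>\<^bsub>R\<^esub> \<in> V" "?\<pi> u \<noteq> ?\<pi> \<one>\<^bsub>R\<^esub>"
    using u one Icarr[OF u(1)] \<open>\<zero>\<^bsub>R\<^esub> \<in> P\<close> assms(5) by auto
  note main = powers_of_multipartite_edge_ideal[where 'k = 'k, OF V this]
  have "has_linear_resolution V (2 * n) (ideal_power V I n) \<and>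
      regularity V (ideal_power V I n) = 2 * int n" for n
    using main[of n] unfolding I by simp
  then show ?thesis unfolding has_linear_powers_def by blast
qed

end
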